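(* Let $d\ge 1$, $K\ge 1$ be integers, $\alpha>0$, $T>0$, and let $X^K_{uv,k}\in\mathbb{R}$ ($u\in\{1,\dots,d\}$, $v\in\{0,1,\dots,d\}$, $k\in\{0,\dots,K\}$) be the coefficients of the $K$-approximation of a $d$-dimensional multivariate Hawkes process $N$, obtained from i.i.d. realizations of $N$ over $[0,T]$ and regarded as given. Let $\widehat{N}^K=(\widehat{N}^{K,1},\dots,\widehat{N}^{K,d})$ be the $d$-dimensional Hawkes process on $[0,T]$ defined by the background rates and kernels $$\widehat{\mu}^K_u(t)=\sum_{k=0}^K X^K_{u0,k}e^{-k\alpha t},\qquad \widehat{g}^K_{uv}(t)=\sum_{k=0}^K X^K_{uv,k}e^{-k\alpha t},\qquad u,v\in\{1,\dots,d\},$$ and let $\widehat{\lambda}^K_u$ denote the stochastic rate of occurrence of $\widehat{N}^{K,u}$. Then there exist $\mathbb{R}^d$-valued processes $\widehat{\ell}^0,\widehat{\ell}^1,\dots,\widehat{\ell}^K$ on $[0,T]$, with components $\widehat{\ell}^k=(\widehat{\ell}^k_u)_{1\le u\le d}$, such that $$\forall u\in\{1,\dots,d\},\qquad \widehat{\lambda}^K_u(t)=\Big(\sum_{k=0}^K\widehat{\ell}^k_u(t)\Big)_+ ,$$ and $\big(\widehat{N}^K(t),\widehat{\ell}^0(t),\widehat{\ell}^1(t),\dots,\widehat{\ell}^K(t)\big)$ is a Markov process on $\mathbb{N}^d\times\mathbb{R}^{d(K+1)}$.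
   Context: For $x\in\mathbb{R}$, $x_+=\max(x,0)$. A $d$-dimensional (multivariate) Hawkes process with background rates $\mu_u$ and triggering kernels $g_{uv}$ (real-valued, possibly negative), $u,v\in\{1,\dots,d\}$, is a $d$-dimensional counting process $N(t)=(N^1(t),\dots,N^d(t))$, started with empty history at time $0$, whose component $N^u$ has stochastic rate of occurrence (conditional intensity given the past of $N$) $$\lambda_u(t)=\Big(\mu_u(t)+\sum_{v=1}^d\ \sum_{t_v<t} g_{uv}(t-t_v)\Big)_+,$$ where the inner sum runs over the occurrence times $t_v$ of events of type $v$ (jump times of $N^v$) before $t$. The $K$-approximation of such a process replaces $\mu_u$ and $g_{uv}$ by the finite linear combinations $\widehat{\mu}^K_u$ and $\widehat{g}^K_{uv}$ of the functions $t\mapsto e^{-k\alpha t}$, $0\le k\le K$, with real coefficients $X^K_{u0,k}$ and $X^K_{uv,k}$ respectively. *)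

theory Defs
  imports "HOL-Probability.Probability"
begin

text \<open>Stochastic processes on \<open>[0,T]\<close> are functions \<open>Z t \<omega>\<close> (with a leading component index \<open>u\<close> in the
  multivariate case) on the sample space of a measure \<open>M\<close>; values at times outside \<open>[0,T]\<close> are
  irrelevant. Types of events are numbered \<open>1, \<dots>, d\<close>.\<close>

definition past :: "'w measure \<Rightarrow> 'b measure \<Rightarrow> (real \<Rightarrow> 'w \<Rightarrow> 'b) \<Rightarrow> real \<Rightarrow> 'w measure" where
  "past M S Z t = sigma (space M) {Z s -` B \<inter> space M | s B. s \<in> {0..t} \<and> B \<in> sets S}"

definition markov_process ::
    "'w measure \<Rightarrow> 'b measure \<Rightarrow> real \<Rightarrow> (real \<Rightarrow> 'w \<Rightarrow> 'b) \<Rightarrow> bool" where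
  "markov_process M S T Z \<longleftrightarrow> prob_space M \<and>
     (\<forall>t\<in>{0..T}. Z t \<in> measurable M S) \<and>
     (\<forall>s\<in>{0..T}. \<forall>t\<in>{s..T}. \<forall>B\<in>sets S.
        AE \<omega> in M.
          real_cond_exp M (past M S Z s) (\<lambda>\<omega>. indicator B (Z t \<omega>)) \<omega> =
          real_cond_exp M (vimage_algebra (space M) (Z s) S) (\<lambda>\<omega>. indicator B (Z t \<omega>)) \<omega>)"

definition jump_times :: "real \<Rightarrow> (real \<Rightarrow> nat) \<Rightarrow> real set" where
  "jump_times T f = {t \<in> {0<..T}. \<not> (f \<longlongrightarrow> f t) (at_left t)}"

text \<open>A counting path has finitely many jumps and counts them. This amounts to: it starts at \<open>0\<close>
  and is a right-continuous nondecreasing step function whose jumps all have size \<open>1\<close>.\<close>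

definition counting_path :: "real \<Rightarrow> (real \<Rightarrow> nat) \<Rightarrow> bool" where
  "counting_path T f \<longleftrightarrow> finite (jump_times T f) \<and>
     (\<forall>t\<in>{0..T}. f t = card (jump_times T f \<inter> {..t}))"

text \<open>As usual for multivariate point processes, two components almost surely never jump at the
  same time. The intensities of the components would not determine the joint law otherwise.\<close>

definition counting_process ::
    "'w measure \<Rightarrow> nat \<Rightarrow> real \<Rightarrow> (nat \<Rightarrow> real \<Rightarrow> 'w \<Rightarrow> nat) \<Rightarrow> bool" where
  "counting_process M d T N \<longleftrightarrow>
     (\<forall>u\<in>{1..d}. \<forall>t\<in>{0..T}. N u t \<in> measurable M (count_space UNIV)) \<and>
     (\<forall>u\<in>{1..d}. \<forall>\<omega>\<in>space M. counting_path T (\<lambda>t. N u t \<omega>)) \<and>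
     (AE \<omega> in M. \<forall>u\<in>{1..d}. \<forall>v\<in>{1..d}. u \<noteq> v \<longrightarrow>
        jump_times T (\<lambda>t. N u t \<omega>) \<inter> jump_times T (\<lambda>t. N v t \<omega>) = {})"

abbreviation count_state :: "nat \<Rightarrow> (nat \<Rightarrow> nat) measure" where
  "count_state d \<equiv> PiM {1..d} (\<lambda>u. count_space UNIV)"

abbreviation real_state :: "nat \<Rightarrow> nat \<Rightarrow> (nat \<Rightarrow> nat \<Rightarrow> real) measure" where
  "real_state d K \<equiv> PiM {0..K} (\<lambda>k. PiM {1..d} (\<lambda>u. borel))"

definition history ::
    "'w measure \<Rightarrow> nat \<Rightarrow> (nat \<Rightarrow> real \<Rightarrow> 'w \<Rightarrow> nat) \<Rightarrow> real \<Rightarrow> 'w measure" where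
  "history M d N = past M (count_state d) (\<lambda>t \<omega>. \<lambda>u\<in>{1..d}. N u t \<omega>)"

text \<open>The predictable sigma-algebra on \<open>(0,T] \<times> \<Omega>\<close>; time \<open>0\<close> is left out because counting
  processes have no jump there.\<close>

definition predictable :: "'w measure \<Rightarrow> (real \<Rightarrow> 'w measure) \<Rightarrow> real \<Rightarrow> (real \<times> 'w) measure" where
  "predictable M F T = sigma ({0<..T} \<times> space M)
     {{s<..t} \<times> A | s t A. 0 \<le> s \<and> s \<le> t \<and> t \<le> T \<and> A \<in> sets (F s)}"

text \<open>The (predictable) stochastic intensity of a counting process with respect to a history,
  in the sense of Bremaud, Point Processes and Queues, Chapter II: \<open>E \<integral> C dN = E \<integral> C(t) lam(t) dt\<close>
  for all nonnegative predictable \<open>C\<close>. The integral against \<open>dN\<close> is the sum over the jump times.\<close>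

definition has_intensity ::
    "'w measure \<Rightarrow> (real \<Rightarrow> 'w measure) \<Rightarrow> real \<Rightarrow> (real \<Rightarrow> 'w \<Rightarrow> nat) \<Rightarrow> (real \<Rightarrow> 'w \<Rightarrow> real) \<Rightarrow> bool"
  where
  "has_intensity M F T N lam \<longleftrightarrow>
     (\<forall>t\<in>{0..T}. N t \<in> measurable (F t) (count_space UNIV)) \<and>
     (\<forall>t\<in>{0..T}. \<forall>\<omega>\<in>space M. 0 \<le> lam t \<omega>) \<and>
     (\<lambda>(t, \<omega>). lam t \<omega>) \<in> borel_measurable (predictable M F T) \<and>
     (AE \<omega> in M. (\<integral>\<^sup>+t\<in>{0<..T}. ennreal (lam t \<omega>) \<partial>lborel) < \<infinity>) \<and>
     (\<forall>C \<in> borel_measurable (predictable M F T).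
        (\<integral>\<^sup>+\<omega>. (\<Sum>t\<in>jump_times T (\<lambda>t. N t \<omega>). C (t, \<omega>)) \<partial>M) =
        (\<integral>\<^sup>+\<omega>. (\<integral>\<^sup>+t\<in>{0<..T}. C (t, \<omega>) * ennreal (lam t \<omega>) \<partial>lborel) \<partial>M))"

definition hawkes_rate ::
    "nat \<Rightarrow> real \<Rightarrow> (nat \<Rightarrow> real \<Rightarrow> real) \<Rightarrow> (nat \<Rightarrow> nat \<Rightarrow> real \<Rightarrow> real) \<Rightarrow>
     (nat \<Rightarrow> real \<Rightarrow> 'w \<Rightarrow> nat) \<Rightarrow> nat \<Rightarrow> real \<Rightarrow> 'w \<Rightarrow> real" where
  "hawkes_rate d T \<mu> g N u t \<omega> =
     max (\<mu> u t + (\<Sum>v=1..d. \<Sum>s\<in>jump_times T (\<lambda>r. N v r \<omega>) \<inter> {..<t}. g u v (t - s))) 0"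

definition hawkes_process ::
    "'w measure \<Rightarrow> nat \<Rightarrow> real \<Rightarrow> (nat \<Rightarrow> real \<Rightarrow> real) \<Rightarrow> (nat \<Rightarrow> nat \<Rightarrow> real \<Rightarrow> real) \<Rightarrow>
     (nat \<Rightarrow> real \<Rightarrow> 'w \<Rightarrow> nat) \<Rightarrow> bool" where
  "hawkes_process M d T \<mu> g N \<longleftrightarrow> prob_space M \<and> counting_process M d T N \<and>
     (\<forall>u\<in>{1..d}. has_intensity M (history M d N) T (N u) (hawkes_rate d T \<mu> g N u))"

definition exp_comb :: "nat \<Rightarrow> real \<Rightarrow> (nat \<Rightarrow> real) \<Rightarrow> real \<Rightarrow> real" where
  "exp_comb K \<alpha> c t = (\<Sum>k=0..K. c k * exp (- (real k * \<alpha> * t)))"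

end

theory Submission
  imports Defs
begin

text \<open>
  Put \<open>l k u t = X u 0 k * exp (- k * \<alpha> * t) + (\<Sum>v. \<Sum>s. X u v k * exp (- k * \<alpha> * (t - s)))\<close>, where \<open>s\<close> runs
  over the events of type \<open>v\<close> before \<open>t\<close>. Exchanging the sums over \<open>k\<close> and over the events shows that
  the rate of \<open>u\<close> is the positive part of \<open>\<Sum>k. l k u t\<close>. An exponential kernel forgets the age of an
  event: between events \<open>l k u\<close> just decays by the factor \<open>exp (- k * \<alpha> * h)\<close>, and an event of type \<open>v\<close> adds
  \<open>X u v k\<close> to it. Hence the pair of counts and levels follows a deterministic flow between the events,
  is displaced by a fixed map at each event, and the rates of the events are functions of
  the current pair. This is why it is Markov, and the proof treats every process of this kind.

  For a measurable set \<open>B\<close> of states let \<open>reach B n h z\<close> be the probability that such a process, started in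
  \<open>z\<close>, lies in \<open>B\<close> after time \<open>h\<close> and has then counted exactly \<open>n\<close> events; it is defined by
  conditioning on the first event, recursively in the number of events still to come. The aim is
  \<open>E (1\<^sub>A * reach B n (t - s) (Y s)) = E (1\<^sub>A * reach B n 0 (Y t))\<close> for \<open>A\<close> in the history at time \<open>s\<close>
  (\<open>reach_martingale\<close>): since \<open>reach B n 0\<close> is the indicator of \<open>B\<close> with \<open>n\<close> events, summing over \<open>n\<close> then
  exhibits the conditional probability of \<open>Y t \<in> B\<close> as a function of \<open>Y s\<close>, both for
  the whole past and for the present state (\<open>markov_modification\<close>).

  The aim is reached as follows. The renewal equation of \<open>reach\<close> implies, by Tonelli and the
  fundamental theorem of calculus (\<open>duhamel\<close>), that along each path \<open>reach B n (t - r) (Y r)\<close> changes by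
  its increments at the events, plus the integral of the total rate times \<open>reach\<close>, minus the
  integral of the rates times \<open>reach\<close> after an event (\<open>reach_path_balance\<close>). By
  the defining property of an intensity, the expected sums over the events cancel against the
  expected integrals. Everything is written as an equation between sums of nonnegative terms, so
  the cancellation only asks for finite expected sums; they are finite because \<open>reach B n\<close> is at most \<open>1\<close>
  and vanishes once more than \<open>n\<close> events have been counted.

  Intensities are integrated against predictable processes, so \<open>Y t\<close> is taken to be the state just
  before \<open>t\<close>. It almost surely agrees with the counts and levels at \<open>t\<close>, since a fixed time is
  almost surely not an event time.
\<close>

section \<open>Survival functions and the balance equation of a renewal integral\<close>

lemma borel_measurable_indicator_Ioc [measurable (raw)]:
  fixes a b f :: "'a \<Rightarrow> real"
  assumes [measurable]: "a \<in> borel_measurable M" "b \<in> borel_measurable M" "f \<in> borel_measurable M"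
  shows "(\<lambda>x. indicator {a x<..b x} (f x) :: ennreal) \<in> borel_measurable M"
proof -
  have "(\<lambda>x. if a x < f x \<and> f x \<le> b x then 1 else 0 :: ennreal) \<in> borel_measurable M"
    by measurable
  then show ?thesis by (simp add: indicator_def)
qed

text \<open>If events occur at rate \<open>\<Lambda>\<close>, with integrated rate \<open>I\<close>, then going back from \<open>b\<close> one either meets a last
  event in \<open>{a<..b}\<close>, with density \<open>\<Lambda> x * exp (I x - I b)\<close>, or none; the two probabilities add up to \<open>1\<close>.\<close>

lemma survival_FTC:
  fixes \<Lambda> I :: "real \<Rightarrow> real"
  assumes ab: "a \<le> b"
    and deriv: "\<And>x. x \<in> {a..b} \<Longrightarrow> (I has_real_derivative \<Lambda> x) (at x within {a..b})"
    and nonneg: "\<And>x. 0 \<le> \<Lambda> x"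
    and [measurable]: "\<Lambda> \<in> borel_measurable borel" "I \<in> borel_measurable borel"
  shows "(\<integral>\<^sup>+x\<in>{a<..b}. ennreal (\<Lambda> x * exp (I x - I b)) \<partial>lborel) + ennreal (exp (I a - I b)) = 1"
proof -
  have "(\<integral>\<^sup>+x\<in>{a<..b}. ennreal (\<Lambda> x * exp (I x - I b)) \<partial>lborel)
      = (\<integral>\<^sup>+x\<in>{a..b}. ennreal (\<Lambda> x * exp (I x - I b)) \<partial>lborel)"
    by (intro nn_integral_cong_AE AE_I[where N="{a}"]) (auto split: split_indicator)
  also have "\<dots> = ennreal (exp (I b - I b) - exp (I a - I b))"
  proof (rule nn_integral_has_integral_lebesgue')
    have "((\<lambda>x. exp (I x - I b)) has_real_derivative \<Lambda> x * exp (I x - I b)) (at x within {a..b})" if "x \<in> {a..b}" for x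
      using that by (auto intro!: derivative_eq_intros deriv)
    then show "((\<lambda>x. \<Lambda> x * exp (I x - I b)) has_integral (exp (I b - I b) - exp (I a - I b))) {a..b}"
      using ab by (intro fundamental_theorem_of_calculus) (auto simp: has_real_derivative_iff_has_vector_derivative)
  qed (use nonneg in auto)
  finally have eq: "(\<integral>\<^sup>+x\<in>{a<..b}. ennreal (\<Lambda> x * exp (I x - I b)) \<partial>lborel) = 1 - ennreal (exp (I a - I b))"
    by (simp add: ennreal_minus flip: ennreal_1)
  have mono: "I a \<le> I b"
  proof (rule DERIV_nonneg_imp_increasing_open[OF ab])
    show "\<exists>y. (I has_real_derivative y) (at x) \<and> 0 \<le> y" if "a < x" "x < b" for x
      using deriv[of x] nonneg[of x] that at_within_Icc_at[of a x b] by auto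
    show "continuous_on {a..b} I"
      using deriv by (intro DERIV_continuous_on) auto
  qed
  show ?thesis unfolding eq using mono by (intro diff_add_cancel_ennreal) auto
qed

text \<open>The hypothesis is the variation-of-constants formula for the backward equation \<open>F' = \<Lambda> F - H\<close>;
  the conclusion is that equation in integrated form. As \<open>H\<close> is merely measurable, \<open>F\<close> need not be
  differentiable everywhere; instead the formula is inserted into \<open>\<integral>\<Lambda> F\<close>, the order of integration is
  exchanged, and the inner integrals are evaluated by \<open>survival_FTC\<close>. Subtraction is avoided
  throughout, so that infinite values do no harm.\<close>

lemma duhamel:
  fixes \<Lambda> I :: "real \<Rightarrow> real" and H F :: "real \<Rightarrow> ennreal"
  assumes ab: "a \<le> b"
    and deriv: "\<And>x. x \<in> {a..b} \<Longrightarrow> (I has_real_derivative \<Lambda> x) (at x within {a..b})"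
    and nonneg: "\<And>x. 0 \<le> \<Lambda> x"
    and [measurable]: "\<Lambda> \<in> borel_measurable borel" "I \<in> borel_measurable borel" "H \<in> borel_measurable borel"
    and F: "\<And>x. x \<in> {a..b} \<Longrightarrow> F x = ennreal (exp (I x - I b)) * F b + (\<integral>\<^sup>+q\<in>{x<..b}. ennreal (exp (I x - I q)) * H q \<partial>lborel)"
  shows "F a + (\<integral>\<^sup>+x\<in>{a<..b}. ennreal (\<Lambda> x) * F x \<partial>lborel) = F b + (\<integral>\<^sup>+x\<in>{a<..b}. H x \<partial>lborel)"
proof -
  define S where "S x q = ennreal (exp (I x - I q))" for x q
  have [measurable]: "case_prod S \<in> borel_measurable (borel \<Otimes>\<^sub>M borel)" "S x \<in> borel_measurable borel" 
     "(\<lambda>x. S x q) \<in> borel_measurable borel" for x q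
    unfolding S_def by measurable
  have FTC: "(\<integral>\<^sup>+x\<in>{a<..q}. ennreal (\<Lambda> x) * S x q \<partial>lborel) + S a q = 1" if "q \<in> {a..b}" for q
  proof -
    have "(\<integral>\<^sup>+x\<in>{a<..q}. ennreal (\<Lambda> x * exp (I x - I q)) \<partial>lborel) + ennreal (exp (I a - I q)) = 1"
      using that by (intro survival_FTC nonneg DERIV_subset[OF deriv]) auto
    then show ?thesis by (simp add: S_def ennreal_mult nonneg)
  qed
  have "(\<integral>\<^sup>+x\<in>{a<..b}. ennreal (\<Lambda> x) * F x \<partial>lborel) =
      (\<integral>\<^sup>+x. (ennreal (\<Lambda> x) * S x b * indicator {a<..b} x) * F b
        + (\<integral>\<^sup>+q. ennreal (\<Lambda> x) * indicator {a<..b} x * (S x q * H q * indicator {x<..b} q) \<partial>lborel) \<partial>lborel)"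
  proof (intro nn_integral_cong)
    fix x
    show "ennreal (\<Lambda> x) * F x * indicator {a<..b} x = ennreal (\<Lambda> x) * S x b * indicator {a<..b} x * F b
        + (\<integral>\<^sup>+q. ennreal (\<Lambda> x) * indicator {a<..b} x * (S x q * H q * indicator {x<..b} q) \<partial>lborel)"
    proof (cases "x \<in> {a<..b}")
      case True
      then have "F x = S x b * F b + (\<integral>\<^sup>+q\<in>{x<..b}. S x q * H q \<partial>lborel)"
        unfolding S_def by (intro F) auto
      then show ?thesis using True by (simp add: nn_integral_cmult distrib_left mult.assoc)
    qed simp
  qed
  also have "\<dots> = (\<integral>\<^sup>+x\<in>{a<..b}. ennreal (\<Lambda> x) * S x b \<partial>lborel) * F b
     + (\<integral>\<^sup>+x. (\<integral>\<^sup>+q. ennreal (\<Lambda> x) * indicator {a<..b} x * (S x q * H q * indicator {x<..b} q) \<partial>lborel) \<partial>lborel)"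
    by (subst nn_integral_add) (auto simp: nn_integral_multc)
  also have "(\<integral>\<^sup>+x. (\<integral>\<^sup>+q. ennreal (\<Lambda> x) * indicator {a<..b} x * (S x q * H q * indicator {x<..b} q) \<partial>lborel) \<partial>lborel)
      = (\<integral>\<^sup>+q. (\<integral>\<^sup>+x. ennreal (\<Lambda> x) * indicator {a<..b} x * (S x q * H q * indicator {x<..b} q) \<partial>lborel) \<partial>lborel)"
    by (rule lborel_pair.Fubini') simp
  also have "\<dots> = (\<integral>\<^sup>+q. (\<integral>\<^sup>+x\<in>{a<..q}. ennreal (\<Lambda> x) * S x q \<partial>lborel) * (H q * indicator {a<..b} q) \<partial>lborel)"
  proof (intro nn_integral_cong)
    fix q
    have "(\<integral>\<^sup>+x. ennreal (\<Lambda> x) * indicator {a<..b} x * (S x q * H q * indicator {x<..b} q) \<partial>lborel)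
      = (\<integral>\<^sup>+x. (ennreal (\<Lambda> x) * S x q * indicator {a<..q} x) * (H q * indicator {a<..b} q) \<partial>lborel)"
      by (intro nn_integral_cong_AE AE_I[where N="{q}"]) (auto split: split_indicator simp: mult_ac)
    also have "\<dots> = (\<integral>\<^sup>+x\<in>{a<..q}. ennreal (\<Lambda> x) * S x q \<partial>lborel) * (H q * indicator {a<..b} q)"
      by (rule nn_integral_multc) simp
    finally show "(\<integral>\<^sup>+x. ennreal (\<Lambda> x) * indicator {a<..b} x * (S x q * H q * indicator {x<..b} q) \<partial>lborel) = \<dots>" .
  qed
  finally have 1: "(\<integral>\<^sup>+x\<in>{a<..b}. ennreal (\<Lambda> x) * F x \<partial>lborel) =
      (\<integral>\<^sup>+x\<in>{a<..b}. ennreal (\<Lambda> x) * S x b \<partial>lborel) * F b +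
      (\<integral>\<^sup>+q. (\<integral>\<^sup>+x\<in>{a<..q}. ennreal (\<Lambda> x) * S x q \<partial>lborel) * (H q * indicator {a<..b} q) \<partial>lborel)" .
  have 2: "F a = S a b * F b + (\<integral>\<^sup>+q. S a q * (H q * indicator {a<..b} q) \<partial>lborel)"
    using F[of a] ab by (simp add: S_def mult.assoc)
  have "F a + (\<integral>\<^sup>+x\<in>{a<..b}. ennreal (\<Lambda> x) * F x \<partial>lborel) =
     ((\<integral>\<^sup>+x\<in>{a<..b}. ennreal (\<Lambda> x) * S x b \<partial>lborel) + S a b) * F b +
     (\<integral>\<^sup>+q. ((\<integral>\<^sup>+x\<in>{a<..q}. ennreal (\<Lambda> x) * S x q \<partial>lborel) + S a q) * (H q * indicator {a<..b} q) \<partial>lborel)"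
    unfolding 1 2 by (simp add: nn_integral_add distrib_right add_ac)
  also have "\<dots> = F b + (\<integral>\<^sup>+x\<in>{a<..b}. H x \<partial>lborel)"
    using FTC[of b] ab
    by (auto intro!: arg_cong2[where f="(+)"] nn_integral_cong split: split_indicator simp: FTC)
  finally show ?thesis .
qed

section \<open>Deterministic flow with state-dependent jump rates\<close>

text \<open>A state \<open>z\<close> moves along \<open>flow\<close> until an event of some type \<open>u\<close> happens, at rate \<open>rate u\<close>, which
  replaces the state by its image under \<open>jump u\<close>. The state contains the number \<open>count\<close> of past events;
  it serves to cut off the possibly unbounded number of events. Taking \<open>flow\<close> as an
  action of all real times frees the group law of sign conditions.\<close>

locale jump_flow =
  fixes S :: "'s measure" and U :: "'u set"
    and flow :: "real \<Rightarrow> 's \<Rightarrow> 's" and jump :: "'u \<Rightarrow> 's \<Rightarrow> 's"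
    and rate :: "'u \<Rightarrow> 's \<Rightarrow> real" and count :: "'s \<Rightarrow> nat"
  assumes finite_U: "finite U"
    and flow_measurable: "(\<lambda>(q, z). flow q z) \<in> borel \<Otimes>\<^sub>M S \<rightarrow>\<^sub>M S"
    and jump_measurable [measurable]: "u \<in> U \<Longrightarrow> jump u \<in> S \<rightarrow>\<^sub>M S"
    and rate_measurable [measurable]: "u \<in> U \<Longrightarrow> rate u \<in> borel_measurable S"
    and count_measurable [measurable]: "count \<in> S \<rightarrow>\<^sub>M count_space UNIV"
    and rate_nonneg: "0 \<le> rate u z"
    and flow_0: "z \<in> space S \<Longrightarrow> flow 0 z = z"
    and flow_add: "z \<in> space S \<Longrightarrow> flow p (flow q z) = flow (p + q) z"
    and rate_continuous: "z \<in> space S \<Longrightarrow> u \<in> U \<Longrightarrow> continuous_on UNIV (\<lambda>q. rate u (flow q z))"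
    and count_flow: "z \<in> space S \<Longrightarrow> count (flow q z) = count z"
    and count_jump: "z \<in> space S \<Longrightarrow> u \<in> U \<Longrightarrow> count (jump u z) = Suc (count z)"
begin

lemma measurable_flow [measurable (raw)]:
  assumes [measurable]: "f \<in> borel_measurable M" "g \<in> M \<rightarrow>\<^sub>M S"
  shows "(\<lambda>x. flow (f x) (g x)) \<in> M \<rightarrow>\<^sub>M S"
  using measurable_compose[OF _ flow_measurable, of "\<lambda>x. (f x, g x)" M] by simp

lemma flow_in_space [simp]: "z \<in> space S \<Longrightarrow> flow q z \<in> space S"
  by (rule measurable_space[OF measurable_flow[of "\<lambda>_. q" S "\<lambda>z. z"]]) auto

lemma jump_in_space [simp]: "u \<in> U \<Longrightarrow> z \<in> space S \<Longrightarrow> jump u z \<in> space S"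
  by (rule measurable_space[OF jump_measurable])

definition total_rate :: "'s \<Rightarrow> real" where
  "total_rate z = (\<Sum>u\<in>U. rate u z)"

lemma total_rate_nonneg: "0 \<le> total_rate z"
  unfolding total_rate_def by (intro sum_nonneg rate_nonneg)

lemma total_rate_measurable [measurable]: "total_rate \<in> borel_measurable S"
  unfolding total_rate_def by measurable

lemma total_rate_continuous: "z \<in> space S \<Longrightarrow> continuous_on A (\<lambda>q. total_rate (flow q z))"
  unfolding total_rate_def by (intro continuous_on_sum continuous_on_subset[OF rate_continuous]) auto

definition hazard :: "'s \<Rightarrow> real \<Rightarrow> real" where
  "hazard z q = (LINT x:{0<..q}|lborel. total_rate (flow x z))"

lemma hazard_measurable [measurable (raw)]:
  assumes [measurable]: "f \<in> borel_measurable M" "g \<in> M \<rightarrow>\<^sub>M S"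
  shows "(\<lambda>x. hazard (g x) (f x)) \<in> borel_measurable M"
proof -
  have *: "(\<lambda>x. LINT q|lborel. (if 0 < q \<and> q \<le> f x then total_rate (flow q (g x)) else 0)) \<in> borel_measurable M"
    by measurable
  show ?thesis
    by (rule measurable_cong[THEN iffD1, OF _ *])
       (auto intro!: Bochner_Integration.integral_cong simp: hazard_def set_lebesgue_integral_def split: split_indicator)
qed

lemma hazard_eq_integral:
  assumes "z \<in> space S"
  shows "hazard z q = integral {0..q} (\<lambda>x. total_rate (flow x z))"
proof -
  have "hazard z q = (LINT x:{0..q}|lborel. total_rate (flow x z))"
    unfolding hazard_def set_lebesgue_integral_def using assms
    by (intro integral_cong_AE AE_I[where N="{0}"]) (auto split: split_indicator)
  also have "\<dots> = integral {0..q} (\<lambda>x. total_rate (flow x z))"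
    by (intro set_borel_integral_eq_integral borel_integrable_atLeastAtMost' total_rate_continuous assms)
  finally show ?thesis .
qed

lemma hazard_deriv:
  assumes z: "z \<in> space S" and x: "x \<in> {0..b}"
  shows "(hazard z has_real_derivative total_rate (flow x z)) (at x within {0..b})"
  unfolding hazard_eq_integral[OF z, abs_def]
  by (rule integral_has_real_derivative[OF total_rate_continuous[OF z] x])

lemma hazard_0: "hazard z 0 = 0"
  by (simp add: hazard_def set_lebesgue_integral_def)

lemma hazard_flow:
  assumes z: "z \<in> space S" and "0 \<le> p" "0 \<le> q"
  shows "hazard (flow p z) q = hazard z (p + q) - hazard z p"
proof -
  let ?f = "\<lambda>x. total_rate (flow x z)"
  have int: "?f integrable_on {a..b}" for a b
    by (intro integrable_continuous_real total_rate_continuous z)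
  have "hazard (flow p z) q = integral {0..q} (\<lambda>x. ?f (x + p))"
    using z by (simp add: hazard_eq_integral flow_add)
  also have "\<dots> = integral {0+p..q+p} ?f"
    using integral_shift_real_ivl[of p p "p + q" ?f] by (simp add: add.commute)
  also have "\<dots> = integral {0..p+q} ?f - integral {0..p} ?f"
    using Henstock_Kurzweil_Integration.integral_combine[where a=0 and c=p and b="p+q" and f="?f"] assms int
    by (auto simp: add.commute)
  finally show ?thesis using z by (simp add: hazard_eq_integral)
qed

text \<open>The probability that a process started in \<open>z\<close> has exactly \<open>j\<close> events up to time \<open>h\<close> and is in \<open>B\<close> at
  time \<open>h\<close>; the second equation integrates over the time \<open>q\<close> of the first event.\<close>

primrec arrival :: "'s set \<Rightarrow> nat \<Rightarrow> real \<Rightarrow> 's \<Rightarrow> ennreal" where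
  "arrival B 0 h z = ennreal (exp (- hazard z h)) * indicator B (flow h z)"
| "arrival B (Suc j) h z = (\<integral>\<^sup>+q\<in>{0<..h}. ennreal (exp (- hazard z q)) *
     (\<Sum>u\<in>U. ennreal (rate u (flow q z)) * arrival B j (h - q) (jump u (flow q z))) \<partial>lborel)"

lemma arrival_measurable [measurable (raw)]:
  assumes B [measurable]: "B \<in> sets S" and "f \<in> borel_measurable M" "g \<in> M \<rightarrow>\<^sub>M S"
  shows "(\<lambda>x. arrival B j (f x) (g x)) \<in> borel_measurable M"
proof -
  have "(\<lambda>x. arrival B j (fst x) (snd x)) \<in> borel_measurable (borel \<Otimes>\<^sub>M S)"
  proof (induction j)
    case 0
    show ?case by simp
  next
    case (Suc j)
    have [measurable (raw)]: "(\<lambda>x. arrival B j (f x) (g x)) \<in> borel_measurable M"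
      if "f \<in> borel_measurable M" "g \<in> M \<rightarrow>\<^sub>M S" for f g and M :: "'c measure"
      using measurable_compose[OF _ Suc, of "\<lambda>x. (f x, g x)" M] that by simp
    show ?case by simp
  qed
  from measurable_compose[OF _ this, of "\<lambda>x. (f x, g x)" M] assms show ?thesis by simp
qed

text \<open>In contrast to \<open>arrival\<close>, the index \<open>n\<close> is the value of \<open>count\<close> at the end. It does not change when an
  event happens, and this makes \<open>reach B n\<close> satisfy one single linear equation.\<close>

definition reach :: "'s set \<Rightarrow> nat \<Rightarrow> real \<Rightarrow> 's \<Rightarrow> ennreal" where
  "reach B n h z = (if count z \<le> n then arrival B (n - count z) h z else 0)"

lemma reach_measurable [measurable (raw)]:
  assumes [measurable]: "B \<in> sets S" "f \<in> borel_measurable M" "g \<in> M \<rightarrow>\<^sub>M S"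
  shows "(\<lambda>x. reach B n (f x) (g x)) \<in> borel_measurable M"
proof -
  have "(\<lambda>x. \<Sum>i\<le>n. (if count (g x) = i then arrival B (n - i) (f x) (g x) else 0)) \<in> borel_measurable M"
    by measurable
  also have "(\<lambda>x. \<Sum>i\<le>n. (if count (g x) = i then arrival B (n - i) (f x) (g x) else 0)) = (\<lambda>x. reach B n (f x) (g x))"
    by (simp add: reach_def fun_eq_iff)
  finally show ?thesis .
qed

definition reach_gain :: "'s set \<Rightarrow> nat \<Rightarrow> real \<Rightarrow> 's \<Rightarrow> ennreal" where
  "reach_gain B n h z = (\<Sum>u\<in>U. ennreal (rate u z) * reach B n h (jump u z))"

lemma reach_gain_measurable [measurable (raw)]:
  assumes [measurable]: "B \<in> sets S" "f \<in> borel_measurable M" "g \<in> M \<rightarrow>\<^sub>M S"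
  shows "(\<lambda>x. reach_gain B n (f x) (g x)) \<in> borel_measurable M"
  unfolding reach_gain_def by measurable

lemma reach_0:
  assumes "z \<in> space S"
  shows "reach B n 0 z = (if count z = n then indicator B z else 0)"
proof (cases "n - count z")
  case 0 then show ?thesis using assms by (auto simp: reach_def hazard_0 flow_0)
next
  case (Suc m) then show ?thesis by (auto simp: reach_def)
qed

text \<open>The three cases \<open>count z < n\<close>, \<open>count z = n\<close> and \<open>count z > n\<close> look different in the definition, but
  all fit this one form: the first summand vanishes unless \<open>count z = n\<close>, the second unless \<open>count z < n\<close>.\<close>

lemma reach_renewal:
  assumes z: "z \<in> space S"
  shows "reach B n h z = ennreal (exp (- hazard z h)) * reach B n 0 (flow h z)
    + (\<integral>\<^sup>+q\<in>{0<..h}. ennreal (exp (- hazard z q)) * reach_gain B n (h - q) (flow q z) \<partial>lborel)"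
proof -
  consider "n < count z" | "n = count z" | "count z < n" by linarith
  then show ?thesis
  proof cases
    case 1
    then show ?thesis using z by (simp add: reach_def reach_gain_def count_flow count_jump)
  next
    case 2
    then show ?thesis using z by (simp add: reach_0 reach_def[of _ _ h] reach_def[of _ _ "h - _"] reach_gain_def count_flow count_jump)
  next
    case 3
    then obtain j where j: "n - count z = Suc j" "n - Suc (count z) = j"
      by (metis Suc_diff_Suc)
    show ?thesis using 3 z j
      by (auto simp: reach_0 reach_def[of _ _ h] reach_def[of _ _ "h - _"] reach_gain_def count_flow count_jump
           intro!: nn_integral_cong)
  qed
qed

section \<open>Balance of reach probabilities along a path\<close>

text \<open>The renewal equation stops the flow only at the horizon \<open>h\<close>. Here it is stopped at an intermediate
  time \<open>b\<close>: the part of the integral beyond \<open>b\<close> is the renewal equation started at \<open>flow b z\<close>,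
  because survival probabilities multiply.\<close>

lemma reach_along_flow:
  assumes z [measurable, simp]: "z \<in> space S" and [measurable]: "B \<in> sets S" and x: "0 \<le> x" "x \<le> b" "b \<le> h"
  shows "reach B n (h - x) (flow x z) = ennreal (exp (hazard z x - hazard z b)) * reach B n (h - b) (flow b z)
    + (\<integral>\<^sup>+q\<in>{x<..b}. ennreal (exp (hazard z x - hazard z q)) * reach_gain B n (h - q) (flow q z) \<partial>lborel)"
proof -
  define e where "e x q = ennreal (exp (hazard z x - hazard z q))" for x q
  define G where "G q = reach_gain B n (h - q) (flow q z)" for q
  define c where "c = reach B n 0 (flow h z)"
  have [measurable]: "e x \<in> borel_measurable borel" "G \<in> borel_measurable borel" for x
    unfolding e_def G_def by measurable
  have e_mult: "e x q * e q r = e x r" for x q r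
    by (simp add: e_def ennreal_mult[symmetric] exp_add[symmetric])
  have horizon: "reach B n (h - x) (flow x z) = e x h * c + (\<integral>\<^sup>+q\<in>{x<..h}. e x q * G q \<partial>lborel)"
    if "0 \<le> x" "x \<le> h" for x
  proof -
    have "(\<integral>\<^sup>+q\<in>{x<..h}. e x q * G q \<partial>lborel)
        = (\<integral>\<^sup>+q. e x (x + 1 * q) * G (x + 1 * q) * indicator {x<..h} (x + 1 * q) \<partial>lborel)"
      using nn_integral_real_affine[of "\<lambda>q. e x q * G q * indicator {x<..h} q" 1 x] by simp
    also have "\<dots> = (\<integral>\<^sup>+q\<in>{0<..h - x}. ennreal (exp (- hazard (flow x z) q)) * reach_gain B n (h - x - q) (flow q (flow x z)) \<partial>lborel)"
      using that by (intro nn_integral_cong) (auto simp: e_def G_def hazard_flow flow_add algebra_simps split: split_indicator)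
    finally show ?thesis
      using that by (subst reach_renewal) (simp_all add: hazard_flow flow_add e_def c_def)
  qed
  \<comment> \<open>beyond \<open>b\<close>, the factor \<open>e x b\<close> splits off and the rest is the horizon formula at \<open>b\<close>\<close>
  have "{x<..h} = {x<..b} \<union> {b<..h}" using x by auto
  then have "(\<integral>\<^sup>+q\<in>{x<..h}. e x q * G q \<partial>lborel)
      = (\<integral>\<^sup>+q\<in>{x<..b}. e x q * G q \<partial>lborel) + (\<integral>\<^sup>+q\<in>{b<..h}. e x q * G q \<partial>lborel)"
    by (simp only:) (rule nn_integral_disjoint_pair, auto)
  also have "(\<integral>\<^sup>+q\<in>{b<..h}. e x q * G q \<partial>lborel) = e x b * (\<integral>\<^sup>+q\<in>{b<..h}. e b q * G q \<partial>lborel)"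
    by (simp add: nn_integral_cmult[symmetric] e_mult mult.assoc[symmetric])
  finally have "reach B n (h - x) (flow x z)
      = (\<integral>\<^sup>+q\<in>{x<..b}. e x q * G q \<partial>lborel) + e x b * (e b h * c + (\<integral>\<^sup>+q\<in>{b<..h}. e b q * G q \<partial>lborel))"
    using x by (simp add: horizon[of x] distrib_left e_mult mult.assoc[symmetric] add_ac)
  then show ?thesis
    using x by (simp add: horizon[of b] e_def G_def add_ac)
qed

lemma reach_flow_balance:
  assumes z [measurable]: "z \<in> space S" and [measurable]: "B \<in> sets S" and b: "0 \<le> b" "b \<le> h"
  shows "reach B n h z + (\<integral>\<^sup>+x\<in>{0<..b}. ennreal (total_rate (flow x z)) * reach B n (h - x) (flow x z) \<partial>lborel)
    = reach B n (h - b) (flow b z) + (\<integral>\<^sup>+x\<in>{0<..b}. reach_gain B n (h - x) (flow x z) \<partial>lborel)"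
proof -
  have "reach B n (h - 0) (flow 0 z) + (\<integral>\<^sup>+x\<in>{0<..b}. ennreal (total_rate (flow x z)) * reach B n (h - x) (flow x z) \<partial>lborel)
    = reach B n (h - b) (flow b z) + (\<integral>\<^sup>+x\<in>{0<..b}. reach_gain B n (h - x) (flow x z) \<partial>lborel)"
  proof (rule duhamel[where I="hazard z"])
    show "(hazard z has_real_derivative total_rate (flow x z)) (at x within {0..b})" if "x \<in> {0..b}" for x
      by (rule hazard_deriv[OF z that])
    show "reach B n (h - x) (flow x z) = ennreal (exp (hazard z x - hazard z b)) * reach B n (h - b) (flow b z)
      + (\<integral>\<^sup>+q\<in>{x<..b}. ennreal (exp (hazard z x - hazard z q)) * reach_gain B n (h - q) (flow q z) \<partial>lborel)"
      if "x \<in> {0..b}" for x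
      using that b by (intro reach_along_flow z) auto
  qed (use b total_rate_nonneg in auto)
  then show ?thesis by (simp add: flow_0 z)
qed

text \<open>The left-hand side is the probability that the first event happens before \<open>h\<close>.\<close>

lemma survival_total:
  assumes z: "z \<in> space S" and h: "0 \<le> h"
  shows "(\<integral>\<^sup>+x\<in>{0<..h}. ennreal (exp (- hazard z x)) * ennreal (total_rate (flow x z)) \<partial>lborel) \<le> 1"
proof -
  have "(\<integral>\<^sup>+x\<in>{0<..h}. ennreal (exp (- hazard z x)) * ennreal (total_rate (flow x z)) \<partial>lborel)
      = (\<integral>\<^sup>+x\<in>{0..h}. ennreal (exp (- hazard z x) * total_rate (flow x z)) \<partial>lborel)"
    using total_rate_nonneg
    by (intro nn_integral_cong_AE AE_I[where N="{0}"]) (auto simp: ennreal_mult split: split_indicator)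
  also have "\<dots> = ennreal (- exp (- hazard z h) - - exp (- hazard z 0))"
  proof (rule nn_integral_has_integral_lebesgue')
    have "((\<lambda>x. - exp (- hazard z x)) has_real_derivative exp (- hazard z x) * total_rate (flow x z)) (at x within {0..h})" 
      if "x \<in> {0..h}" for x
      using that by (auto intro!: derivative_eq_intros hazard_deriv[OF z])
    then show "((\<lambda>x. exp (- hazard z x) * total_rate (flow x z)) has_integral (- exp (- hazard z h) - - exp (- hazard z 0))) {0..h}"
      using h by (intro fundamental_theorem_of_calculus) (auto simp: has_real_derivative_iff_has_vector_derivative)
  qed (use total_rate_nonneg in auto)
  also have "\<dots> \<le> 1" by (simp add: hazard_0 ennreal_le_1)
  finally show ?thesis .
qed

lemma arrival_le_1: "z \<in> space S \<Longrightarrow> 0 \<le> h \<Longrightarrow> arrival B j h z \<le> 1"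
proof (induction j arbitrary: h z)
  case 0
  have "0 \<le> hazard z h"
    unfolding hazard_def set_lebesgue_integral_def
    by (intro Bochner_Integration.integral_nonneg) (auto simp: total_rate_nonneg)
  then show ?case by (auto split: split_indicator)
next
  case (Suc j)
  have "arrival B (Suc j) h z \<le> (\<integral>\<^sup>+q\<in>{0<..h}. ennreal (exp (- hazard z q)) * ennreal (total_rate (flow q z)) \<partial>lborel)"
    unfolding arrival.simps
  proof (intro nn_integral_mono)
    fix q
    have "ennreal (rate u (flow q z)) * arrival B j (h - q) (jump u (flow q z)) \<le> ennreal (rate u (flow q z))"
      if "q \<in> {0<..h}" "u \<in> U" for u
      using mult_left_mono[OF Suc.IH[of "jump u (flow q z)" "h - q"], of "ennreal (rate u (flow q z))"] that Suc.prems by simp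
    then have "(\<Sum>u\<in>U. ennreal (rate u (flow q z)) * arrival B j (h - q) (jump u (flow q z))) \<le> ennreal (total_rate (flow q z))"
      if "q \<in> {0<..h}"
      using that unfolding total_rate_def sum_ennreal[OF rate_nonneg, symmetric] by (intro sum_mono)
    then show "ennreal (exp (- hazard z q)) *
          (\<Sum>u\<in>U. ennreal (rate u (flow q z)) * arrival B j (h - q) (jump u (flow q z))) * indicator {0<..h} q
        \<le> ennreal (exp (- hazard z q)) * ennreal (total_rate (flow q z)) * indicator {0<..h} q"
      by (auto split: split_indicator intro: mult_left_mono)
  qed
  also have "\<dots> \<le> 1" by (rule survival_total[OF Suc.prems])
  finally show ?case .
qed

lemma reach_le_1: "z \<in> space S \<Longrightarrow> 0 \<le> h \<Longrightarrow> reach B n h z \<le> 1"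
  by (simp add: reach_def arrival_le_1)

text \<open>At \<open>c\<close> itself the path \<open>y\<close> may differ from \<open>z\<close>: in a left-continuous path, \<open>z\<close> is the
  state immediately after an event at \<open>c\<close>.\<close>

lemma reach_segment_balance:
  fixes y :: "real \<Rightarrow> 's"
  assumes y [measurable]: "y \<in> borel \<rightarrow>\<^sub>M S" and B [measurable]: "B \<in> sets S"
    and z [measurable]: "z \<in> space S" and b: "c \<le> b" "b \<le> t"
    and seg: "\<And>r. c < r \<Longrightarrow> r \<le> b \<Longrightarrow> y r = flow (r - c) z"
  shows "reach B n (t - c) z + (\<integral>\<^sup>+r\<in>{c<..b}. ennreal (total_rate (y r)) * reach B n (t - r) (y r) \<partial>lborel)
    = reach B n (t - b) (flow (b - c) z) + (\<integral>\<^sup>+r\<in>{c<..b}. reach_gain B n (t - r) (y r) \<partial>lborel)"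
proof -
  have shift: "(\<integral>\<^sup>+r\<in>{c<..b}. f r (y r) \<partial>lborel) = (\<integral>\<^sup>+x\<in>{0<..b - c}. f (c + x) (flow x z) \<partial>lborel)"
    if [measurable]: "(\<lambda>r. f r (y r)) \<in> borel_measurable borel" for f :: "real \<Rightarrow> 's \<Rightarrow> ennreal"
  proof -
    have "(\<integral>\<^sup>+r\<in>{c<..b}. f r (y r) \<partial>lborel)
        = (\<integral>\<^sup>+x. f (c + 1 * x) (y (c + 1 * x)) * indicator {c<..b} (c + 1 * x) \<partial>lborel)"
      using nn_integral_real_affine[of "\<lambda>r. f r (y r) * indicator {c<..b} r" 1 c] by simp
    also have "\<dots> = (\<integral>\<^sup>+x\<in>{0<..b - c}. f (c + x) (flow x z) \<partial>lborel)"
      by (intro nn_integral_cong) (auto simp: seg split: split_indicator)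
    finally show ?thesis .
  qed
  show ?thesis
    using reach_flow_balance[OF z B, of "b - c" "t - c" n] b
      shift[of "\<lambda>r z. ennreal (total_rate z) * reach B n (t - r) z"]
      shift[of "\<lambda>r z. reach_gain B n (t - r) z"]
    by (simp add: diff_diff_eq)
qed

text \<open>The fundamental theorem of calculus for \<open>reach B n (t - r) (y r)\<close> along a left-continuous path with
  finitely many events \<open>J\<close>, where \<open>m r\<close> is the type of the event at \<open>r\<close>. Induction on \<open>J\<close> peels off the last
  event: the stretch after it is a segment of the flow.\<close>

lemma reach_path_balance:
  fixes y :: "real \<Rightarrow> 's" and m :: "real \<Rightarrow> 'u"
  assumes y [measurable]: "y \<in> borel \<rightarrow>\<^sub>M S" and B [measurable]: "B \<in> sets S"
    and m: "\<And>r. r \<in> J \<Longrightarrow> m r \<in> U"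
    and "finite J" "J \<subseteq> {a..<b}" "a \<le> b" "b \<le> t"
    and "\<And>r q. a \<le> r \<Longrightarrow> r \<le> q \<Longrightarrow> q \<le> b \<Longrightarrow> J \<inter> {r..<q} = {} \<Longrightarrow> y q = flow (q - r) (y r)"
    and "\<And>r q. r \<in> J \<Longrightarrow> r < q \<Longrightarrow> q \<le> b \<Longrightarrow> J \<inter> {r<..<q} = {} \<Longrightarrow> y q = flow (q - r) (jump (m r) (y r))"
  shows "reach B n (t - a) (y a) + (\<Sum>r\<in>J. reach B n (t - r) (jump (m r) (y r)))
      + (\<integral>\<^sup>+r\<in>{a<..b}. ennreal (total_rate (y r)) * reach B n (t - r) (y r) \<partial>lborel)
    = reach B n (t - b) (y b) + (\<Sum>r\<in>J. reach B n (t - r) (y r))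
      + (\<integral>\<^sup>+r\<in>{a<..b}. reach_gain B n (t - r) (y r) \<partial>lborel)"
  using assms(4,3,5-)
proof (induction J arbitrary: b rule: finite_linorder_max_induct)
  case empty
  have ya: "y a \<in> space S" by (rule measurable_space[OF y]) simp
  have seg: "y r = flow (r - a) (y a)" if "a \<le> r" "r \<le> b" for r
    using that by (intro empty.prems) auto
  have "y b = flow (b - a) (y a)" using empty.prems(3) by (intro seg) auto
  then show ?case
    using reach_segment_balance[OF y B ya empty.prems(3,4) seg, of n] by simp
next
  case (insert \<tau> J)
  note prems = insert.prems
  have \<tau>: "a \<le> \<tau>" "\<tau> < b" "m \<tau> \<in> U" using prems by auto
  have notin: "\<tau> \<notin> J" using insert.hyps by auto
  have y\<tau>: "jump (m \<tau>) (y \<tau>) \<in> space S"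
    using measurable_space[OF y, of \<tau>] \<tau> by simp
  have seg: "y r = flow (r - \<tau>) (jump (m \<tau>) (y \<tau>))" if "\<tau> < r" "r \<le> b" for r
  proof (rule prems(6))
    show "insert \<tau> J \<inter> {\<tau><..<r} = {}" using insert.hyps(2) by force
  qed (use that in auto)
  have yb: "y b = flow (b - \<tau>) (jump (m \<tau>) (y \<tau>))" using \<tau> by (intro seg) auto
  have right: "reach B n (t - \<tau>) (jump (m \<tau>) (y \<tau>)) + (\<integral>\<^sup>+r\<in>{\<tau><..b}. ennreal (total_rate (y r)) * reach B n (t - r) (y r) \<partial>lborel)
    = reach B n (t - b) (y b) + (\<integral>\<^sup>+r\<in>{\<tau><..b}. reach_gain B n (t - r) (y r) \<partial>lborel)"
    unfolding yb using \<tau> prems(4) by (intro reach_segment_balance y B y\<tau> seg) auto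
  have left: "reach B n (t - a) (y a) + (\<Sum>r\<in>J. reach B n (t - r) (jump (m r) (y r)))
      + (\<integral>\<^sup>+r\<in>{a<..\<tau>}. ennreal (total_rate (y r)) * reach B n (t - r) (y r) \<partial>lborel)
    = reach B n (t - \<tau>) (y \<tau>) + (\<Sum>r\<in>J. reach B n (t - r) (y r))
      + (\<integral>\<^sup>+r\<in>{a<..\<tau>}. reach_gain B n (t - r) (y r) \<partial>lborel)"
  proof (rule insert.IH)
    show "y q = flow (q - r) (y r)" if "a \<le> r" "r \<le> q" "q \<le> \<tau>" "J \<inter> {r..<q} = {}" for r q
      by (rule prems(5)) (use that \<tau> in auto)
    show "y q = flow (q - r) (jump (m r) (y r))" if "r \<in> J" "r < q" "q \<le> \<tau>" "J \<inter> {r<..<q} = {}" for r q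
      by (rule prems(6)) (use that \<tau> in auto)
  qed (use prems(1,2,4) insert.hyps \<tau> in auto)
  have split: "(\<integral>\<^sup>+r\<in>{a<..b}. f r \<partial>lborel) = (\<integral>\<^sup>+r\<in>{a<..\<tau>}. f r \<partial>lborel) + (\<integral>\<^sup>+r\<in>{\<tau><..b}. f r \<partial>lborel)"
    if "f \<in> borel_measurable borel" for f :: "real \<Rightarrow> ennreal"
  proof -
    have "{a<..b} = {a<..\<tau>} \<union> {\<tau><..b}" using \<tau> by auto
    then show ?thesis using that by (simp only:) (rule nn_integral_disjoint_pair, auto)
  qed
  show ?case
    using arg_cong2[OF left right, where f="(+)"] notin insert.hyps(1)
    by (simp add: split add_ac)
qed

end

section \<open>Predictable processes over a finite horizon\<close>

locale finite_horizon_filtration = prob_space M for M :: "'w measure" +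
  fixes F :: "real \<Rightarrow> 'w measure" and T :: real
  assumes F_space: "space (F t) = space M"
    and F_mono: "0 \<le> s \<Longrightarrow> s \<le> t \<Longrightarrow> t \<le> T \<Longrightarrow> sets (F s) \<subseteq> sets (F t)"
    and F_sub: "0 \<le> t \<Longrightarrow> t \<le> T \<Longrightarrow> sets (F t) \<subseteq> sets M"
begin

abbreviation Pred :: "(real \<times> 'w) measure" where
  "Pred \<equiv> predictable M F T"

definition rectangles :: "(real \<times> 'w) set set" where
  "rectangles = {{s<..t} \<times> A | s t A. 0 \<le> s \<and> s \<le> t \<and> t \<le> T \<and> A \<in> sets (F s)}"

lemma rectangles_subset: "rectangles \<subseteq> Pow ({0<..T} \<times> space M)"
  unfolding rectangles_def using sets.sets_into_space F_space by fastforce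

lemma space_predictable: "space Pred = {0<..T} \<times> space M"
  unfolding predictable_def by (simp add: space_measure_of_conv)

lemma sets_predictable: "sets Pred = sigma_sets ({0<..T} \<times> space M) rectangles"
  unfolding predictable_def rectangles_def[symmetric] by (rule sets_measure_of[OF rectangles_subset])

lemma rectangle_predictable:
  "0 \<le> s \<Longrightarrow> s \<le> t \<Longrightarrow> t \<le> T \<Longrightarrow> A \<in> sets (F s) \<Longrightarrow> {s<..t} \<times> A \<in> sets Pred"
  unfolding sets_predictable by (rule sigma_sets.Basic) (auto simp: rectangles_def)

lemma F_measurable_mono:
  assumes "f \<in> measurable (F s) S" "0 \<le> s" "s \<le> t" "t \<le> T"
  shows "f \<in> measurable (F t) S"
  using assms F_mono[of s t] by (intro measurable_from_subalg[of "F t" "F s"]) (auto simp: subalgebra_def F_space)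

lemma F_measurable_M:
  assumes "f \<in> measurable (F s) S" "0 \<le> s" "s \<le> T"
  shows "f \<in> measurable M S"
  using assms F_sub[of s] by (intro measurable_from_subalg[of M "F s"]) (auto simp: subalgebra_def F_space)

lemma rectangles_Int_stable: "Int_stable rectangles"
proof (rule Int_stableI)
  fix a b assume "a \<in> rectangles" "b \<in> rectangles"
  then obtain s t A s' t' A' where a: "a = {s<..t} \<times> A" "0 \<le> s" "s \<le> t" "t \<le> T" "A \<in> sets (F s)"
    and b: "b = {s'<..t'} \<times> A'" "0 \<le> s'" "s' \<le> t'" "t' \<le> T" "A' \<in> sets (F s')"
    unfolding rectangles_def by auto
  \<comment> \<open>the outer maximum keeps \<open>?s \<le> ?t\<close> when the two time intervals are disjoint\<close>
  let ?s = "max s s'" and ?t = "max (max s s') (min t t')"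
  have "A \<inter> A' \<in> sets (F ?s)"
    using a b F_mono[of s ?s] F_mono[of s' ?s] by (intro sets.Int) auto
  moreover have "a \<inter> b = {?s<..?t} \<times> (A \<inter> A')"
    using a b by auto
  ultimately show "a \<inter> b \<in> rectangles"
    unfolding rectangles_def mem_Collect_eq using a b by (intro exI[of _ ?s] exI[of _ ?t] exI[of _ "A \<inter> A'"]) auto
qed

text \<open>Sampling at the last point of a grid of width \<open>1 / Suc n\<close> strictly before \<open>r\<close> gives a process that
  is constant in time on grid cells and there measurable with respect to the past of the cell. By
  left-continuity these processes converge to \<open>X\<close>.\<close>

lemma left_continuous_adapted_predictable:
  fixes X :: "real \<Rightarrow> 'w \<Rightarrow> 'b :: metric_space"
  assumes adapted: "\<And>t. 0 \<le> t \<Longrightarrow> t \<le> T \<Longrightarrow> X t \<in> borel_measurable (F t)"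
    and left: "\<And>r \<omega>. 0 < r \<Longrightarrow> r \<le> T \<Longrightarrow> \<omega> \<in> space M \<Longrightarrow> ((\<lambda>x. X x \<omega>) \<longlongrightarrow> X r \<omega>) (at_left r)"
  shows "(\<lambda>(r, \<omega>). X r \<omega>) \<in> borel_measurable Pred"
proof -
  \<comment> \<open>the largest multiple of \<open>1 / Suc n\<close> that is strictly smaller than \<open>r\<close>\<close>
  define g where "g n r = (of_int \<lceil>r * real (Suc n)\<rceil> - 1) / real (Suc n)" for n :: nat and r :: real
  have g_less: "g n r < r" for n r
    unfolding g_def by (simp add: divide_less_eq del: of_nat_Suc) linarith
  have g_ge: "r - 1 / real (Suc n) \<le> g n r" for n r
  proof -
    have "r = (r * real (Suc n)) / real (Suc n)" by simp
    then have "r - 1 / real (Suc n) = (r * real (Suc n) - 1) / real (Suc n)"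
      by (simp add: diff_divide_distrib)
    also have "\<dots> \<le> g n r"
      unfolding g_def by (intro divide_right_mono) (auto simp del: of_nat_Suc)
    finally show ?thesis .
  qed
  have lim: "filterlim (\<lambda>n. g n r) (at_left r) sequentially" for r
  proof -
    have "(\<lambda>n. g n r) \<longlonglongrightarrow> r"
    proof (rule tendsto_sandwich)
      show "(\<lambda>n. r - 1 / real (Suc n)) \<longlonglongrightarrow> r"
        using LIMSEQ_inverse_real_of_nat_add_minus[of r] by (simp add: inverse_eq_divide)
    qed (use g_ge g_less in \<open>auto intro!: always_eventually less_imp_le\<close>)
    then show ?thesis unfolding filterlim_at using g_less by (auto intro!: always_eventually simp: less_imp_neq)
  qed
  show ?thesis
  proof (rule borel_measurable_LIMSEQ_metric)
    fix n
    show "(\<lambda>(r, \<omega>). X (g n r) \<omega>) \<in> borel_measurable Pred"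
    proof (rule measurableI)
      fix B :: "'b set" assume B: "B \<in> sets borel"
      define a where "a i = real i / real (Suc n)" for i
      have a: "0 \<le> a i" "a i \<le> a (Suc i)" for i
        by (auto simp: a_def divide_right_mono)
      have g_eq: "g n r = a i" if "r \<in> {a i<..a (Suc i)}" for r i
      proof -
        have "\<lceil>r * real (Suc n)\<rceil> = int (Suc i)"
          using that by (intro ceiling_unique) (auto simp: a_def field_simps)
        then show ?thesis by (simp add: g_def a_def)
      qed
      have cover: "\<exists>i. r \<in> {a i<..a (Suc i)}" if "0 < r" for r
      proof -
        define i where "i = nat (\<lceil>r * real (Suc n)\<rceil> - 1)"
        have "0 < r * real (Suc n)" using that by (intro mult_pos_pos) auto
        then have "1 \<le> \<lceil>r * real (Suc n)\<rceil>" by linarith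
        then have "real i = of_int \<lceil>r * real (Suc n)\<rceil> - 1" by (simp add: i_def)
        then have "real i < r * real (Suc n)" "r * real (Suc n) \<le> real (Suc i)" by linarith+
        then show ?thesis by (intro exI[of _ i]) (auto simp: a_def pos_divide_less_eq pos_le_divide_eq simp del: of_nat_Suc)
      qed
      have "(\<lambda>(r, \<omega>). X (g n r) \<omega>) -` B \<inter> space Pred
        = (\<Union>i\<in>{i. a i \<le> T}. {a i<..min (a (Suc i)) T} \<times> (X (a i) -` B \<inter> space M))"
      proof (intro set_eqI iffI)
        fix x assume x: "x \<in> (\<lambda>(r, \<omega>). X (g n r) \<omega>) -` B \<inter> space Pred"
        obtain r \<omega> where [simp]: "x = (r, \<omega>)" by (cases x)
        from x have r: "0 < r" "r \<le> T" "\<omega> \<in> space M" "X (g n r) \<omega> \<in> B" by (auto simp: space_predictable)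
        obtain i where "r \<in> {a i<..a (Suc i)}" using cover r by blast
        then show "x \<in> (\<Union>i\<in>{i. a i \<le> T}. {a i<..min (a (Suc i)) T} \<times> (X (a i) -` B \<inter> space M))"
          using r g_eq by (intro UN_I[of i]) auto
      next
        fix x assume "x \<in> (\<Union>i\<in>{i. a i \<le> T}. {a i<..min (a (Suc i)) T} \<times> (X (a i) -` B \<inter> space M))"
        then obtain i r \<omega> where "x = (r, \<omega>)" "a i < r" "r \<le> a (Suc i)" "r \<le> T" "X (a i) \<omega> \<in> B" "\<omega> \<in> space M"
          by auto
        then show "x \<in> (\<lambda>(r, \<omega>). X (g n r) \<omega>) -` B \<inter> space Pred"
          using a(1)[of i] g_eq[of r i] by (auto simp: space_predictable)
      qed
      also have "\<dots> \<in> sets Pred"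
      proof (intro sets.countable_UN'' rectangle_predictable)
        fix i assume "i \<in> {i. a i \<le> T}"
        then show "X (a i) -` B \<inter> space M \<in> sets (F (a i))"
          using measurable_sets[OF adapted B, of "a i"] a by (simp add: F_space)
      qed (use a in auto)
      finally show "(\<lambda>(r, \<omega>). X (g n r) \<omega>) -` B \<inter> space Pred \<in> sets Pred" .
    qed simp
  next
    fix x assume "x \<in> space Pred"
    then show "(\<lambda>n. (\<lambda>(r, \<omega>). X (g n r) \<omega>) x) \<longlonglongrightarrow> (\<lambda>(r, \<omega>). X r \<omega>) x"
      by (auto simp: space_predictable intro!: filterlim_compose[OF left lim])
  qed
qed

lemma predictable_product_measurable:
  fixes f :: "real \<times> 'w \<Rightarrow> ennreal"
  assumes "f \<in> borel_measurable Pred"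
  shows "(\<lambda>x. f x * indicator ({0<..T} \<times> space M) x) \<in> borel_measurable (borel \<Otimes>\<^sub>M M)"
proof -
  let ?\<Omega> = "{0<..T} \<times> space M"
  let ?R = "restrict_space (borel \<Otimes>\<^sub>M M) ?\<Omega>"
  have \<Omega>: "?\<Omega> \<inter> space (borel \<Otimes>\<^sub>M M) \<in> sets (borel \<Otimes>\<^sub>M M)" by auto
  have "rectangles \<subseteq> sets ?R"
  proof
    fix a assume "a \<in> rectangles"
    then obtain s t A where a: "a = {s<..t} \<times> A" "0 \<le> s" "s \<le> t" "t \<le> T" "A \<in> sets (F s)"
      unfolding rectangles_def by auto
    then have A: "A \<in> sets M" using F_sub[of s] by auto
    then have "A \<subseteq> space M" by (rule sets.sets_into_space)
    moreover have "a \<in> sets (borel \<Otimes>\<^sub>M M)" using a A by auto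
    ultimately show "a \<in> sets ?R"
      using a \<Omega> by (auto simp: sets_restrict_space_iff)
  qed
  then have "sets Pred \<subseteq> sets ?R"
    unfolding sets_predictable
    by (intro sets.sigma_sets_subset') (auto simp: sets_restrict_space_iff[OF \<Omega>])
  then have "f \<in> borel_measurable ?R"
    using assms by (intro measurable_from_subalg[of ?R Pred])
      (auto simp: subalgebra_def space_predictable space_restrict_space space_pair_measure)
  then show ?thesis
    using borel_measurable_restrict_space_iff_ennreal[OF \<Omega>] by simp
qed

text \<open>For a rectangle \<open>{s<..t} \<times> A\<close> the sum is a difference of two counts, restricted to \<open>A\<close>; the general case
  follows by a monotone class argument, where the finiteness of \<open>J\<close> allows to pass to complements by
  subtracting and to interchange the sum with limits.\<close>

lemma jump_sum_measurable:
  fixes f :: "real \<times> 'w \<Rightarrow> ennreal" and J :: "'w \<Rightarrow> real set"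
  assumes f: "f \<in> borel_measurable Pred"
    and J: "\<And>\<omega>. \<omega> \<in> space M \<Longrightarrow> finite (J \<omega>)" "\<And>\<omega>. \<omega> \<in> space M \<Longrightarrow> J \<omega> \<subseteq> {0<..T}"
    and cnt [measurable]: "\<And>t. 0 \<le> t \<Longrightarrow> t \<le> T \<Longrightarrow> (\<lambda>\<omega>. card (J \<omega> \<inter> {..t})) \<in> M \<rightarrow>\<^sub>M count_space UNIV"
    and T: "0 \<le> T"
  shows "(\<lambda>\<omega>. \<Sum>\<tau>\<in>J \<omega>. f (\<tau>, \<omega>)) \<in> borel_measurable M"
proof -
  have in_space: "(\<tau>, \<omega>) \<in> space Pred" if "\<omega> \<in> space M" "\<tau> \<in> J \<omega>" for \<tau> \<omega>
    using J(2)[OF that(1)] that by (auto simp: space_predictable)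
  have sets: "(\<lambda>\<omega>. \<Sum>\<tau>\<in>J \<omega>. indicator D (\<tau>, \<omega>) :: ennreal) \<in> borel_measurable M" if "D \<in> sets Pred" for D
    using that[unfolded sets_predictable]
  proof (induction rule: sigma_sets_induct_disjoint[OF rectangles_Int_stable rectangles_subset, consumes 1, case_names basic empty compl union])
    case (basic D)
    then obtain s t A where D: "D = {s<..t} \<times> A" "0 \<le> s" "s \<le> t" "t \<le> T" "A \<in> sets (F s)"
      unfolding rectangles_def by auto
    then have [measurable]: "A \<in> sets M" using F_sub[of s] by auto
    have [measurable]: "(\<lambda>\<omega>. card (J \<omega> \<inter> {..t})) \<in> M \<rightarrow>\<^sub>M count_space UNIV" 
        "(\<lambda>\<omega>. card (J \<omega> \<inter> {..s})) \<in> M \<rightarrow>\<^sub>M count_space UNIV"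
      using D by (auto intro!: cnt)
    have *: "(\<lambda>\<omega>. indicator A \<omega> * ennreal (real (card (J \<omega> \<inter> {..t})) - real (card (J \<omega> \<inter> {..s})))) \<in> borel_measurable M"
      by measurable
    show ?case
    proof (rule measurable_cong[THEN iffD1, OF _ *])
      fix \<omega> assume \<omega>: "\<omega> \<in> space M"
      have "J \<omega> \<inter> {..t} = J \<omega> \<inter> {s<..t} \<union> J \<omega> \<inter> {..s}" using D by auto
      then have "card (J \<omega> \<inter> {..t}) = card (J \<omega> \<inter> {s<..t}) + card (J \<omega> \<inter> {..s})"
        using J(1)[OF \<omega>] by (simp only:) (rule card_Un_disjoint, auto)
      moreover have "(\<Sum>\<tau>\<in>J \<omega>. indicator D (\<tau>, \<omega>) :: ennreal) = indicator A \<omega> * of_nat (card (J \<omega> \<inter> {s<..t}))"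
        using J(1)[OF \<omega>] by (simp add: D indicator_times sum_distrib_right[symmetric] mult.commute indicator_def
          sum.If_cases Int_def)
      ultimately show "indicator A \<omega> * ennreal (real (card (J \<omega> \<inter> {..t})) - real (card (J \<omega> \<inter> {..s}))) = (\<Sum>\<tau>\<in>J \<omega>. indicator D (\<tau>, \<omega>) :: ennreal)"
        by (simp add: ennreal_of_nat_eq_real_of_nat)
    qed
  next
    case empty
    show ?case by simp
  next
    case (compl D)
    note [measurable] = compl(2)
    have *: "(\<lambda>\<omega>. of_nat (card (J \<omega> \<inter> {..T})) - (\<Sum>\<tau>\<in>J \<omega>. indicator D (\<tau>, \<omega>) :: ennreal)) \<in> borel_measurable M"
      using T by measurable
    show ?case
    proof (rule measurable_cong[THEN iffD1, OF _ *])
      fix \<omega> assume \<omega>: "\<omega> \<in> space M"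
      have "J \<omega> \<inter> {..T} = J \<omega>" using J(2)[OF \<omega>] by auto
      then have "of_nat (card (J \<omega> \<inter> {..T})) = (\<Sum>\<tau>\<in>J \<omega>. 1 :: ennreal)" by simp
      also have "\<dots> = (\<Sum>\<tau>\<in>J \<omega>. indicator ({0<..T} \<times> space M - D) (\<tau>, \<omega>) + indicator D (\<tau>, \<omega>) :: ennreal)"
        using in_space[OF \<omega>] by (intro sum.cong) (auto simp: space_predictable split: split_indicator)
      finally have "of_nat (card (J \<omega> \<inter> {..T})) = 
        (\<Sum>\<tau>\<in>J \<omega>. indicator ({0<..T} \<times> space M - D) (\<tau>, \<omega>)) + (\<Sum>\<tau>\<in>J \<omega>. indicator D (\<tau>, \<omega>) :: ennreal)"
        by (simp add: sum.distrib)
      moreover have "(\<Sum>\<tau>\<in>J \<omega>. indicator D (\<tau>, \<omega>) :: ennreal) < \<top>"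
        using J(1)[OF \<omega>] by (simp add: less_top[symmetric] split: split_indicator)
      ultimately show "of_nat (card (J \<omega> \<inter> {..T})) - (\<Sum>\<tau>\<in>J \<omega>. indicator D (\<tau>, \<omega>) :: ennreal)
         = (\<Sum>\<tau>\<in>J \<omega>. indicator ({0<..T} \<times> space M - D) (\<tau>, \<omega>))"
        by (simp add: ennreal_add_diff_cancel_right less_top)
    qed
  next
    case (union D)
    note [measurable] = union(3)
    have *: "(\<lambda>\<omega>. \<Sum>i. \<Sum>\<tau>\<in>J \<omega>. indicator (D i) (\<tau>, \<omega>) :: ennreal) \<in> borel_measurable M"
      by measurable
    show ?case
    proof (rule measurable_cong[THEN iffD1, OF _ *])
      fix \<omega>
      have "(\<Sum>i. \<Sum>\<tau>\<in>J \<omega>. indicator (D i) (\<tau>, \<omega>) :: ennreal) = (\<Sum>\<tau>\<in>J \<omega>. \<Sum>i. indicator (D i) (\<tau>, \<omega>))"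
        by (rule suminf_sum) auto
      also have "\<dots> = (\<Sum>\<tau>\<in>J \<omega>. indicator (\<Union>i. D i) (\<tau>, \<omega>))"
        by (intro sum.cong refl suminf_indicator union(1))
      finally show "(\<Sum>i. \<Sum>\<tau>\<in>J \<omega>. indicator (D i) (\<tau>, \<omega>) :: ennreal) = (\<Sum>\<tau>\<in>J \<omega>. indicator (\<Union>i. D i) (\<tau>, \<omega>))" .
    qed
  qed
  from f show ?thesis
  proof (induction rule: borel_measurable_induct)
    case (cong f g)
    have "(\<Sum>\<tau>\<in>J \<omega>. f (\<tau>, \<omega>)) = (\<Sum>\<tau>\<in>J \<omega>. g (\<tau>, \<omega>))" if "\<omega> \<in> space M" for \<omega>
      using in_space[OF that] by (intro sum.cong refl cong.hyps(3))
    then show ?case using cong.IH by (rule measurable_cong[THEN iffD2])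
  next
    case (set D)
    then show ?case by (rule sets)
  next
    case (mult u c)
    note [measurable] = mult.IH
    show ?case unfolding sum_distrib_left[symmetric] by measurable
  next
    case (add u v)
    note [measurable] = add.IH
    show ?case unfolding sum.distrib by measurable
  next
    case (seq U)
    note [measurable] = seq.IH
    have *: "(\<lambda>\<omega>. SUP i. \<Sum>\<tau>\<in>J \<omega>. U i (\<tau>, \<omega>)) \<in> borel_measurable M" by measurable
    show ?case
    proof (rule measurable_cong[THEN iffD1, OF _ *])
      fix \<omega> assume \<omega>: "\<omega> \<in> space M"
      have "(SUP i. \<Sum>\<tau>\<in>J \<omega>. U i (\<tau>, \<omega>)) = (SUP i. \<integral>\<^sup>+\<tau>. U i (\<tau>, \<omega>) \<partial>count_space (J \<omega>))"
        using J(1)[OF \<omega>] by (simp add: nn_integral_count_space_finite)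
      also have "\<dots> = (\<integral>\<^sup>+\<tau>. (SUP i. U i (\<tau>, \<omega>)) \<partial>count_space (J \<omega>))"
        using \<open>incseq U\<close> by (intro nn_integral_monotone_convergence_SUP[symmetric]) (auto simp: incseq_def le_fun_def)
      finally show "(SUP i. \<Sum>\<tau>\<in>J \<omega>. U i (\<tau>, \<omega>)) = (\<Sum>\<tau>\<in>J \<omega>. (SUP i. U i) (\<tau>, \<omega>))"
        using J(1)[OF \<omega>] by (simp add: nn_integral_count_space_finite image_comp)
    qed
  qed
qed

lemma time_predictable [measurable]: "fst \<in> borel_measurable Pred"
proof -
  have "(\<lambda>(r, \<omega>). r) \<in> borel_measurable Pred"
    by (rule left_continuous_adapted_predictable) auto
  then show ?thesis by (simp add: case_prod_beta' fst_def[symmetric])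
qed

text \<open>This is \<open>jump_sum_measurable\<close> for the constant filtration \<open>F t\<close> on the horizon \<open>t\<close>: with respect to it, every
  Borel function of time is predictable, in particular \<open>g\<close> cut off at \<open>t\<close>.\<close>

lemma adapted_jump_sum:
  fixes g :: "real \<Rightarrow> real" and J :: "'w \<Rightarrow> real set"
  assumes J: "\<And>\<omega>. \<omega> \<in> space M \<Longrightarrow> finite (J \<omega>)" "\<And>\<omega>. \<omega> \<in> space M \<Longrightarrow> J \<omega> \<subseteq> {0<..T}"
    and cnt: "\<And>r. 0 \<le> r \<Longrightarrow> r \<le> T \<Longrightarrow> (\<lambda>\<omega>. card (J \<omega> \<inter> {..r})) \<in> F r \<rightarrow>\<^sub>M count_space UNIV"
    and t: "0 \<le> t" "t \<le> T"
    and g [measurable]: "g \<in> borel_measurable borel" and nonneg: "\<And>s. 0 \<le> g s"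
  shows "(\<lambda>\<omega>. \<Sum>s\<in>J \<omega> \<inter> {..<t}. g s) \<in> borel_measurable (F t)"
proof -
  have sub: "subalgebra M (F t)" using F_sub[OF t] F_space by (simp add: subalgebra_def)
  let ?M = "restr_to_subalg M (F t)"
  interpret now: finite_horizon_filtration ?M "\<lambda>_. ?M" t
    by (intro finite_horizon_filtration.intro finite_horizon_filtration_axioms.intro
        prob_space_restr_to_subalg sub prob_space_axioms) auto
  have sets: "sets ?M = sets (F t)" and space: "space ?M = space M"
    by (simp_all add: sets_restr_to_subalg[OF sub] space_restr_to_subalg)
  note meas = measurable_cong_sets[OF sets refl]
  have "(\<lambda>x. ennreal (g (fst x)) * indicator {..<t} (fst x)) \<in> borel_measurable now.Pred"
    by measurable
  then have "(\<lambda>\<omega>. \<Sum>s\<in>J \<omega> \<inter> {..t}. ennreal (g (fst (s, \<omega>))) * indicator {..<t} (fst (s, \<omega>))) \<in> borel_measurable ?M"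
  proof (rule now.jump_sum_measurable)
    fix r assume r: "0 \<le> r" "r \<le> t"
    then have "J \<omega> \<inter> {..t} \<inter> {..r} = J \<omega> \<inter> {..r}" for \<omega> by auto
    then show "(\<lambda>\<omega>. card (J \<omega> \<inter> {..t} \<inter> {..r})) \<in> ?M \<rightarrow>\<^sub>M count_space UNIV"
      unfolding meas using F_measurable_mono[OF cnt, of r t] r t by simp
  qed (use J t space in fastforce)+
  then have "(\<lambda>\<omega>. enn2real (\<Sum>s\<in>J \<omega> \<inter> {..t}. ennreal (g (fst (s, \<omega>))) * indicator {..<t} (fst (s, \<omega>)))) \<in> borel_measurable (F t)"
    unfolding meas by measurable
  then show ?thesis
  proof (rule measurable_cong[THEN iffD1, rotated])
    fix \<omega> assume "\<omega> \<in> space (F t)"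
    then have "finite (J \<omega>)" using J(1) F_space by simp
    then have "(\<Sum>s\<in>J \<omega> \<inter> {..t}. ennreal (g (fst (s, \<omega>))) * indicator {..<t} (fst (s, \<omega>))) = (\<Sum>s\<in>J \<omega> \<inter> {..<t}. ennreal (g s))"
      by (intro sum.mono_neutral_cong_right) (auto split: split_indicator)
    then show "enn2real (\<Sum>s\<in>J \<omega> \<inter> {..t}. ennreal (g (fst (s, \<omega>))) * indicator {..<t} (fst (s, \<omega>))) = (\<Sum>s\<in>J \<omega> \<inter> {..<t}. g s)"
      using nonneg by (simp add: sum_nonneg)
  qed
qed

end

section \<open>Processes driven by their intensities\<close>

lemma jump_times_subset: "jump_times T f \<subseteq> {0<..T}"
  by (auto simp: jump_times_def)

text \<open>A marked point process \<open>N\<close> whose intensities are rates of the state \<open>Y\<close>, where \<open>Y r\<close> is the state just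
  before \<open>r\<close>: it does not yet include an event at \<open>r\<close>. Accordingly it follows the flow from \<open>r\<close> to \<open>q\<close> if no
  event happens in \<open>{r..<q}\<close>, and starts from the image of \<open>Y r\<close> under the jump map after an event at \<open>r\<close>.\<close>

locale intensity_driven =
  jump_flow S U flow jump rate count + finite_horizon_filtration M F T
  for S :: "'s measure" and U :: "'u set" and flow jump rate count
    and M :: "'w measure" and F T +
  fixes N :: "'u \<Rightarrow> real \<Rightarrow> 'w \<Rightarrow> nat" and Y :: "real \<Rightarrow> 'w \<Rightarrow> 's"
  assumes T_nonneg: "0 \<le> T"
    and N_measurable: "u \<in> U \<Longrightarrow> 0 \<le> t \<Longrightarrow> t \<le> T \<Longrightarrow> N u t \<in> M \<rightarrow>\<^sub>M count_space UNIV"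
    and N_counting: "u \<in> U \<Longrightarrow> \<omega> \<in> space M \<Longrightarrow> counting_path T (\<lambda>t. N u t \<omega>)"
    and N_disjoint: "AE \<omega> in M. \<forall>u\<in>U. \<forall>v\<in>U. u \<noteq> v \<longrightarrow>
        jump_times T (\<lambda>t. N u t \<omega>) \<inter> jump_times T (\<lambda>t. N v t \<omega>) = {}"
    and N_intensity: "u \<in> U \<Longrightarrow> has_intensity M F T (N u) (\<lambda>t \<omega>. rate u (Y t \<omega>))"
    and Y_predictable [measurable]: "(\<lambda>(r, \<omega>). Y r \<omega>) \<in> predictable M F T \<rightarrow>\<^sub>M S"
    and Y_adapted: "0 \<le> t \<Longrightarrow> t \<le> T \<Longrightarrow> Y t \<in> F t \<rightarrow>\<^sub>M S"
    and Y_path: "\<omega> \<in> space M \<Longrightarrow> (\<lambda>r. Y r \<omega>) \<in> borel \<rightarrow>\<^sub>M S"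
    and Y_flow: "\<omega> \<in> space M \<Longrightarrow> 0 \<le> r \<Longrightarrow> r \<le> q \<Longrightarrow> q \<le> T \<Longrightarrow>
        (\<And>v. v \<in> U \<Longrightarrow> jump_times T (\<lambda>t. N v t \<omega>) \<inter> {r..<q} = {}) \<Longrightarrow> Y q \<omega> = flow (q - r) (Y r \<omega>)"
    and Y_jump: "\<omega> \<in> space M \<Longrightarrow> u \<in> U \<Longrightarrow> r \<in> jump_times T (\<lambda>t. N u t \<omega>) \<Longrightarrow> r < q \<Longrightarrow> q \<le> T \<Longrightarrow>
        (\<And>v. v \<in> U \<Longrightarrow> v \<noteq> u \<Longrightarrow> r \<notin> jump_times T (\<lambda>t. N v t \<omega>)) \<Longrightarrow>
        (\<And>v. v \<in> U \<Longrightarrow> jump_times T (\<lambda>t. N v t \<omega>) \<inter> {r<..<q} = {}) \<Longrightarrow> Y q \<omega> = flow (q - r) (jump u (Y r \<omega>))"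
    and Y_count: "\<omega> \<in> space M \<Longrightarrow> count (Y r \<omega>) = (\<Sum>v\<in>U. card (jump_times T (\<lambda>t. N v t \<omega>) \<inter> {..<r}))"
begin

definition jumps :: "'u \<Rightarrow> 'w \<Rightarrow> real set" where
  "jumps u \<omega> = jump_times T (\<lambda>t. N u t \<omega>)"

lemma jumps_subset: "jumps u \<omega> \<subseteq> {0<..T}"
  unfolding jumps_def by (rule jump_times_subset)

lemma jumps_finite: "u \<in> U \<Longrightarrow> \<omega> \<in> space M \<Longrightarrow> finite (jumps u \<omega>)"
  using N_counting[of u \<omega>] by (simp add: counting_path_def jumps_def)

lemma jump_sum_measurable_N:
  assumes u: "u \<in> U" and f: "f \<in> borel_measurable Pred"
  shows "(\<lambda>\<omega>. \<Sum>\<tau>\<in>jumps u \<omega>. f (\<tau>, \<omega>) :: ennreal) \<in> borel_measurable M"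
proof (rule jump_sum_measurable[OF f])
  fix t assume t: "0 \<le> t" "t \<le> T"
  show "(\<lambda>\<omega>. card (jumps u \<omega> \<inter> {..t})) \<in> M \<rightarrow>\<^sub>M count_space UNIV"
  proof (rule measurable_cong[THEN iffD1, OF _ N_measurable[OF u t]])
    fix \<omega> assume "\<omega> \<in> space M"
    then show "N u t \<omega> = card (jumps u \<omega> \<inter> {..t})"
      using N_counting[OF u] t by (simp add: counting_path_def jumps_def)
  qed
qed (use u jumps_finite jumps_subset T_nonneg in auto)

lemma compensator:
  assumes "u \<in> U" "C \<in> borel_measurable Pred"
  shows "(\<integral>\<^sup>+\<omega>. (\<Sum>\<tau>\<in>jumps u \<omega>. C (\<tau>, \<omega>)) \<partial>M)
    = (\<integral>\<^sup>+\<omega>. (\<integral>\<^sup>+r\<in>{0<..T}. C (r, \<omega>) * ennreal (rate u (Y r \<omega>)) \<partial>lborel) \<partial>M)"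
  using N_intensity[OF assms(1)] assms(2) unfolding has_intensity_def jumps_def by simp

text \<open>The expected number of jumps at time \<open>t\<close> is the integral of the rate over the null set \<open>{t}\<close>.\<close>

lemma no_jump_at_fixed_time:
  assumes u: "u \<in> U"
  shows "AE \<omega> in M. t \<notin> jumps u \<omega>"
proof -
  define C where "C x = (if fst x = t then 1 else 0 :: ennreal)" for x :: "real \<times> 'w"
  have C [measurable]: "C \<in> borel_measurable Pred" unfolding C_def by measurable
  have zero: "(\<integral>\<^sup>+r\<in>{0<..T}. C (r, \<omega>) * ennreal (rate u (Y r \<omega>)) \<partial>lborel) = 0" for \<omega>
  proof -
    have "(\<integral>\<^sup>+r\<in>{0<..T}. C (r, \<omega>) * ennreal (rate u (Y r \<omega>)) \<partial>lborel) = (\<integral>\<^sup>+(r::real). 0 \<partial>lborel)"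
      by (intro nn_integral_cong_AE AE_I[where N="{t}"]) (auto simp: C_def)
    then show ?thesis by simp
  qed
  have "(\<integral>\<^sup>+\<omega>. (\<Sum>\<tau>\<in>jumps u \<omega>. C (\<tau>, \<omega>)) \<partial>M) = 0"
    by (simp add: compensator[OF u C] zero)
  then have "AE \<omega> in M. (\<Sum>\<tau>\<in>jumps u \<omega>. C (\<tau>, \<omega>)) = 0"
    by (subst (asm) nn_integral_0_iff_AE) (intro jump_sum_measurable_N u C)
  with AE_space show ?thesis
  proof eventually_elim
    case (elim \<omega>)
    then have "C (\<tau>, \<omega>) = 0" if "\<tau> \<in> jumps u \<omega>" for \<tau>
      using that jumps_finite[OF u] by (simp add: sum_eq_0_iff)
    from this[of t] show ?case by (auto simp: C_def)
  qed
qed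

text \<open>Each event raises the count, so distinct event times see distinct counts.\<close>

lemma card_low_jumps:
  assumes \<omega>: "\<omega> \<in> space M"
  shows "card {r \<in> (\<Union>u\<in>U. jumps u \<omega>). count (Y r \<omega>) \<le> n} \<le> Suc n"
proof -
  let ?J = "\<Union>u\<in>U. jumps u \<omega>"
  have less: "count (Y r \<omega>) < count (Y q \<omega>)" if r: "r \<in> ?J" "r < q" for r q
  proof -
    from r obtain u where u: "u \<in> U" "r \<in> jumps u \<omega>" by auto
    show ?thesis unfolding Y_count[OF \<omega>] jumps_def[symmetric]
    proof (rule sum_strict_mono_ex1[OF finite_U])
      show "\<forall>v\<in>U. card (jumps v \<omega> \<inter> {..<r}) \<le> card (jumps v \<omega> \<inter> {..<q})"
        using r jumps_finite[OF _ \<omega>] by (auto intro!: card_mono)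
      have "card (jumps u \<omega> \<inter> {..<r}) < card (jumps u \<omega> \<inter> {..<q})"
        using u r jumps_finite[OF u(1) \<omega>] by (intro psubset_card_mono) auto
      then show "\<exists>v\<in>U. card (jumps v \<omega> \<inter> {..<r}) < card (jumps v \<omega> \<inter> {..<q})" using u by auto
    qed
  qed
  have "inj_on (\<lambda>r. count (Y r \<omega>)) ?J"
    by (intro linorder_inj_onI) (use less in fastforce)+
  then have "card {r \<in> ?J. count (Y r \<omega>) \<le> n} = card ((\<lambda>r. count (Y r \<omega>)) ` {r \<in> ?J. count (Y r \<omega>) \<le> n})"
    by (intro card_image[symmetric]) (auto intro: inj_on_subset)
  also have "\<dots> \<le> card {..n}" by (intro card_mono) auto
  finally show ?thesis by simp
qed

lemma Y_in_space: "\<omega> \<in> space M \<Longrightarrow> Y r \<omega> \<in> space S"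
  using measurable_space[OF Y_path, of \<omega> r] by simp

text \<open>Along almost every path, \<open>reach_path_balance\<close> equates the two integrands up to the terms \<open>after\<close>, \<open>before\<close>
  (sums over the events) and \<open>gain\<close>, \<open>loss\<close> (time integrals). The intensity property
  makes \<open>after\<close> and \<open>gain\<close>, and likewise \<open>before\<close> and \<open>loss\<close>, equal in expectation, so they cancel.\<close>

theorem reach_martingale:
  assumes st: "0 \<le> s" "s \<le> t" "t \<le> T" and A: "A \<in> sets (F s)" and B [measurable]: "B \<in> sets S"
  shows "(\<integral>\<^sup>+\<omega>\<in>A. reach B n (t - s) (Y s \<omega>) \<partial>M) = (\<integral>\<^sup>+\<omega>\<in>A. reach B n 0 (Y t \<omega>) \<partial>M)"
proof -
  have AM [measurable]: "A \<in> sets M" using A F_sub[of s] st by auto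
  have Rect [measurable]: "{s<..t} \<times> A \<in> sets Pred" using st A by (intro rectangle_predictable)
  have [measurable]: "Y s \<in> M \<rightarrow>\<^sub>M S" "Y t \<in> M \<rightarrow>\<^sub>M S"
    using F_measurable_M[OF Y_adapted[of s]] F_measurable_M[OF Y_adapted[of t]] st by simp_all
  define C1 where "C1 u x = reach B n (t - fst x) (jump u (case x of (r, \<omega>) \<Rightarrow> Y r \<omega>)) * indicator ({s<..t} \<times> A) x"
    for u and x :: "real \<times> 'w"
  define C2 where "C2 x = reach B n (t - fst x) (case x of (r, \<omega>) \<Rightarrow> Y r \<omega>) * indicator ({s<..t} \<times> A) x"
    for x :: "real \<times> 'w"
  have C1 [measurable]: "C1 u \<in> borel_measurable Pred" if [measurable]: "u \<in> U" for u
    unfolding C1_def by measurable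
  have C2 [measurable]: "C2 \<in> borel_measurable Pred"
    unfolding C2_def by measurable
  define after where "after \<omega> = (\<Sum>u\<in>U. \<Sum>\<tau>\<in>jumps u \<omega>. C1 u (\<tau>, \<omega>))" for \<omega>
  define before where "before \<omega> = (\<Sum>u\<in>U. \<Sum>\<tau>\<in>jumps u \<omega>. C2 (\<tau>, \<omega>))" for \<omega>
  define gain where "gain \<omega> = (\<Sum>u\<in>U. \<integral>\<^sup>+r\<in>{0<..T}. C1 u (r, \<omega>) * ennreal (rate u (Y r \<omega>)) \<partial>lborel)" for \<omega>
  define loss where "loss \<omega> = (\<Sum>u\<in>U. \<integral>\<^sup>+r\<in>{0<..T}. C2 (r, \<omega>) * ennreal (rate u (Y r \<omega>)) \<partial>lborel)" for \<omega>
  have comp_meas [measurable]: "(\<lambda>\<omega>. \<integral>\<^sup>+r\<in>{0<..T}. C (r, \<omega>) * ennreal (rate u (Y r \<omega>)) \<partial>lborel) \<in> borel_measurable M"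
    if u [measurable]: "u \<in> U" and [measurable]: "C \<in> borel_measurable Pred" for C u
  proof -
    have "(\<lambda>x. C x * ennreal (rate u (case x of (r, \<omega>) \<Rightarrow> Y r \<omega>))) \<in> borel_measurable Pred" by measurable
    from predictable_product_measurable[OF this]
    have "(\<lambda>x. C x * ennreal (rate u (case x of (r, \<omega>) \<Rightarrow> Y r \<omega>)) * indicator ({0<..T} \<times> space M) x) \<in> borel_measurable (lborel \<Otimes>\<^sub>M M)"
      by simp
    from measurable_compose[OF measurable_pair_swap' this]
    have "(\<lambda>\<omega>. \<integral>\<^sup>+r. C (r, \<omega>) * ennreal (rate u (Y r \<omega>)) * indicator ({0<..T} \<times> space M) (r, \<omega>) \<partial>lborel) \<in> borel_measurable M"
      by (intro lborel.borel_measurable_nn_integral) (simp add: case_prod_beta')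
    then show ?thesis
      by (rule measurable_cong[THEN iffD1, rotated]) (auto intro!: nn_integral_cong split: split_indicator)
  qed
  have meas [measurable]: "after \<in> borel_measurable M" "before \<in> borel_measurable M"
      "gain \<in> borel_measurable M" "loss \<in> borel_measurable M"
    unfolding after_def before_def gain_def loss_def by (intro borel_measurable_sum jump_sum_measurable_N comp_meas C1 C2; assumption)+
  have after: "(\<integral>\<^sup>+\<omega>. after \<omega> \<partial>M) = (\<integral>\<^sup>+\<omega>. gain \<omega> \<partial>M)"
    unfolding after_def gain_def
    by (simp add: nn_integral_sum jump_sum_measurable_N comp_meas C1 compensator)
  have before: "(\<integral>\<^sup>+\<omega>. before \<omega> \<partial>M) = (\<integral>\<^sup>+\<omega>. loss \<omega> \<partial>M)"
    unfolding before_def loss_def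
    by (simp add: nn_integral_sum jump_sum_measurable_N comp_meas C2 compensator)
  \<comment> \<open>events at the ends are negligible, so the predictable interval \<open>{s<..t}\<close> carries the same events as
    the interval \<open>{s..<t}\<close> that suits the left-continuous path\<close>
  have "AE \<omega> in M. \<forall>u\<in>U. s \<notin> jumps u \<omega> \<and> t \<notin> jumps u \<omega>"
    using no_jump_at_fixed_time finite_U by (simp add: AE_finite_all)
  with N_disjoint AE_space have path: "AE \<omega> in M. before \<omega> \<le> of_nat (Suc n) \<and> after \<omega> \<le> of_nat (Suc n) \<and>
      reach B n (t - s) (Y s \<omega>) * indicator A \<omega> + after \<omega> + loss \<omega>
        = reach B n 0 (Y t \<omega>) * indicator A \<omega> + before \<omega> + gain \<omega>"
  proof eventually_elim
    case (elim \<omega>)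
    show ?case
    proof (cases "\<omega> \<in> A")
      case False
      then show ?thesis by (simp add: after_def before_def gain_def loss_def C1_def C2_def)
    next
      case True
      have \<omega>: "\<omega> \<in> space M" using elim(2) .
      note [measurable] = Y_path[OF \<omega>]
      define K where "K u = jumps u \<omega> \<inter> {s<..t}" for u
      define J where "J = (\<Union>u\<in>U. K u)"
      define m where "m r = (SOME u. u \<in> U \<and> r \<in> jumps u \<omega>)" for r
      have m_eq: "m r = u" if "u \<in> U" "r \<in> jumps u \<omega>" for u r
        unfolding m_def using elim(1) that by (intro some_equality) (auto simp: jumps_def)
      have finK: "finite (K u)" if "u \<in> U" for u
        using jumps_finite[OF that \<omega>] by (simp add: K_def)
      have sum_J: "(\<Sum>u\<in>U. \<Sum>\<tau>\<in>jumps u \<omega>. f u \<tau> * indicator ({s<..t} \<times> A) (\<tau>, \<omega>)) = (\<Sum>r\<in>J. f (m r) r)"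
        for f :: "'u \<Rightarrow> real \<Rightarrow> ennreal"
      proof -
        have "(\<Sum>\<tau>\<in>jumps u \<omega>. f u \<tau> * indicator ({s<..t} \<times> A) (\<tau>, \<omega>)) = (\<Sum>r\<in>K u. f (m r) r)" if "u \<in> U" for u
          using jumps_finite[OF that \<omega>] m_eq[OF that] True
          by (intro sum.mono_neutral_cong_right) (auto simp: K_def)
        moreover have "(\<Sum>r\<in>J. f (m r) r) = (\<Sum>u\<in>U. \<Sum>r\<in>K u. f (m r) r)"
          unfolding J_def using elim(1) finK finite_U by (intro sum.UNION_disjoint) (auto simp: K_def jumps_def)
        ultimately show ?thesis by simp
      qed
      have integral: "(\<Sum>u\<in>U. \<integral>\<^sup>+r\<in>{0<..T}. f u r * indicator ({s<..t} \<times> A) (r, \<omega>) * ennreal (rate u (Y r \<omega>)) \<partial>lborel)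
        = (\<integral>\<^sup>+r\<in>{s<..t}. (\<Sum>u\<in>U. ennreal (rate u (Y r \<omega>)) * f u r) \<partial>lborel)"
        if [measurable]: "\<And>u. u \<in> U \<Longrightarrow> f u \<in> borel_measurable borel" for f
      proof -
        have "(\<Sum>u\<in>U. \<integral>\<^sup>+r\<in>{0<..T}. f u r * indicator ({s<..t} \<times> A) (r, \<omega>) * ennreal (rate u (Y r \<omega>)) \<partial>lborel)
          = (\<Sum>u\<in>U. \<integral>\<^sup>+r\<in>{s<..t}. ennreal (rate u (Y r \<omega>)) * f u r \<partial>lborel)"
          using True st by (intro sum.cong nn_integral_cong) (auto simp: mult_ac split: split_indicator)
        also have "\<dots> = (\<integral>\<^sup>+r\<in>{s<..t}. (\<Sum>u\<in>U. ennreal (rate u (Y r \<omega>)) * f u r) \<partial>lborel)"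
          by (subst nn_integral_sum[symmetric]) (auto simp: sum_distrib_right)
        finally show ?thesis .
      qed
      have after_eq: "after \<omega> = (\<Sum>r\<in>J. reach B n (t - r) (jump (m r) (Y r \<omega>)))"
        unfolding after_def C1_def using sum_J[of "\<lambda>u r. reach B n (t - r) (jump u (Y r \<omega>))"] by simp
      have before_eq: "before \<omega> = (\<Sum>r\<in>J. reach B n (t - r) (Y r \<omega>))"
        unfolding before_def C2_def using sum_J[of "\<lambda>u r. reach B n (t - r) (Y r \<omega>)"] by simp
      have gain_eq: "gain \<omega> = (\<integral>\<^sup>+r\<in>{s<..t}. reach_gain B n (t - r) (Y r \<omega>) \<partial>lborel)"
        unfolding gain_def C1_def reach_gain_def
        using integral[of "\<lambda>u r. reach B n (t - r) (jump u (Y r \<omega>))"] by simp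
      have loss_eq: "loss \<omega> = (\<integral>\<^sup>+r\<in>{s<..t}. ennreal (total_rate (Y r \<omega>)) * reach B n (t - r) (Y r \<omega>) \<partial>lborel)"
        unfolding loss_def C2_def
        using integral[of "\<lambda>u r. reach B n (t - r) (Y r \<omega>)"]
        by (simp add: total_rate_def sum_distrib_right[symmetric] sum_ennreal[OF rate_nonneg])
      have J: "finite J" "J \<subseteq> {s..<t}" "\<And>r. r \<in> J \<Longrightarrow> m r \<in> U"
      proof -
        show "finite J" unfolding J_def by (rule finite_UN_I[OF finite_U finK])
      qed (use elim(3) m_eq in \<open>auto simp: J_def K_def less_le\<close>)
      have balance: "reach B n (t - s) (Y s \<omega>) + after \<omega> + loss \<omega> = reach B n (t - t) (Y t \<omega>) + before \<omega> + gain \<omega>"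
        unfolding after_eq before_eq gain_eq loss_eq
      proof (rule reach_path_balance[OF Y_path[OF \<omega>] B J(3,1,2)])
        fix r q assume r: "s \<le> r" "r \<le> q" "q \<le> t" "J \<inter> {r..<q} = {}"
        show "Y q \<omega> = flow (q - r) (Y r \<omega>)"
        proof (rule Y_flow[OF \<omega>, folded jumps_def])
          fix v assume v: "v \<in> U"
          then have "s \<notin> jumps v \<omega>" using elim(3) by blast
          then show "jumps v \<omega> \<inter> {r..<q} = {}" using r v by (force simp: J_def K_def less_le)
        qed (use r st in auto)
      next
        fix r q assume r: "r \<in> J" "r < q" "q \<le> t" "J \<inter> {r<..<q} = {}"
        then obtain u where u: "u \<in> U" "r \<in> jumps u \<omega>" "s < r" by (auto simp: J_def K_def)
        show "Y q \<omega> = flow (q - r) (jump (m r) (Y r \<omega>))"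
          unfolding m_eq[OF u(1,2)]
        proof (rule Y_jump[OF \<omega> u(1), folded jumps_def])
          show "r \<notin> jumps v \<omega>" if "v \<in> U" "v \<noteq> u" for v
            using elim(1) u that by (auto simp: jumps_def)
          show "jumps v \<omega> \<inter> {r<..<q} = {}" if "v \<in> U" for v
            using r u that by (force simp: J_def K_def)
        qed (use r u st in auto)
      qed (use st in auto)
      have bound: "(\<Sum>r\<in>J. f r) \<le> of_nat (Suc n)"
        if f: "\<And>r. r \<in> J \<Longrightarrow> f r \<le> (if count (Y r \<omega>) \<le> n then 1 else 0)" for f :: "real \<Rightarrow> ennreal"
      proof -
        have "(\<Sum>r\<in>J. f r) \<le> (\<Sum>r\<in>J. if count (Y r \<omega>) \<le> n then 1 else 0)"
          by (intro sum_mono f)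
        also have "\<dots> = of_nat (card {r \<in> J. count (Y r \<omega>) \<le> n})"
          using J(1) by (simp add: sum.If_cases Int_def)
        also have "card {r \<in> J. count (Y r \<omega>) \<le> n} \<le> card {r \<in> (\<Union>u\<in>U. jumps u \<omega>). count (Y r \<omega>) \<le> n}"
          using finite_U jumps_finite \<omega> by (intro card_mono) (auto simp: J_def K_def)
        also note card_low_jumps[OF \<omega>]
        finally show ?thesis by simp
      qed
      have "before \<omega> \<le> of_nat (Suc n)"
        unfolding before_eq
      proof (rule bound)
        fix r assume "r \<in> J"
        then have "0 \<le> t - r" using J(2) by auto
        then have "reach B n (t - r) (Y r \<omega>) \<le> 1" by (intro reach_le_1 Y_in_space[OF \<omega>])
        then show "reach B n (t - r) (Y r \<omega>) \<le> (if count (Y r \<omega>) \<le> n then 1 else 0)"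
          by (simp add: reach_def split: if_splits)
      qed
      moreover have "after \<omega> \<le> of_nat (Suc n)"
        unfolding after_eq
      proof (rule bound)
        fix r assume r: "r \<in> J"
        then have "0 \<le> t - r" using J(2) by auto
        moreover have sp: "jump (m r) (Y r \<omega>) \<in> space S" using J(3)[OF r] Y_in_space[OF \<omega>] by simp
        ultimately have "reach B n (t - r) (jump (m r) (Y r \<omega>)) \<le> 1" by (intro reach_le_1)
        then show "reach B n (t - r) (jump (m r) (Y r \<omega>)) \<le> (if count (Y r \<omega>) \<le> n then 1 else 0)"
          using count_jump[OF Y_in_space[OF \<omega>] J(3)[OF r]] by (auto simp: reach_def)
      qed
      ultimately show ?thesis using balance True by simp
    qed
  qed
  have fin: "(\<integral>\<^sup>+\<omega>. before \<omega> \<partial>M) < \<top>" "(\<integral>\<^sup>+\<omega>. after \<omega> \<partial>M) < \<top>"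
  proof -
    have "(\<integral>\<^sup>+\<omega>. before \<omega> \<partial>M) \<le> (\<integral>\<^sup>+\<omega>. of_nat (Suc n) \<partial>M)" "(\<integral>\<^sup>+\<omega>. after \<omega> \<partial>M) \<le> (\<integral>\<^sup>+\<omega>. of_nat (Suc n) \<partial>M)"
      by (rule nn_integral_mono_AE, rule eventually_mono[OF path], blast)+
    moreover have "(\<integral>\<^sup>+\<omega>. of_nat (Suc n) \<partial>M) < (\<top>::ennreal)"
      by (simp add: emeasure_space_1 ennreal_mult_less_top of_nat_less_top)
    ultimately show "(\<integral>\<^sup>+\<omega>. before \<omega> \<partial>M) < \<top>" "(\<integral>\<^sup>+\<omega>. after \<omega> \<partial>M) < \<top>"
      by (auto intro: le_less_trans)
  qed
  let ?E = "(\<integral>\<^sup>+\<omega>. before \<omega> \<partial>M) + (\<integral>\<^sup>+\<omega>. after \<omega> \<partial>M)"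
  have "(\<integral>\<^sup>+\<omega>\<in>A. reach B n (t - s) (Y s \<omega>) \<partial>M) + ?E
      = (\<integral>\<^sup>+\<omega>. (reach B n (t - s) (Y s \<omega>) * indicator A \<omega> + after \<omega>) + loss \<omega> \<partial>M)"
    by (subst nn_integral_add, simp, simp, subst nn_integral_add) (simp_all add: before add_ac)
  also have "\<dots> = (\<integral>\<^sup>+\<omega>. (reach B n 0 (Y t \<omega>) * indicator A \<omega> + before \<omega>) + gain \<omega> \<partial>M)"
    using path by (intro nn_integral_cong_AE) auto
  also have "\<dots> = (\<integral>\<^sup>+\<omega>\<in>A. reach B n 0 (Y t \<omega>) \<partial>M) + ?E"
    by (subst nn_integral_add, simp, simp, subst nn_integral_add) (simp_all add: after add_ac)
  finally show ?thesis using fin by (auto simp: ennreal_add_left_cancel add.commute[of _ ?E])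
qed

section \<open>The Markov property\<close>

definition transition :: "'s set \<Rightarrow> real \<Rightarrow> 's \<Rightarrow> ennreal" where
  "transition B h z = (\<Sum>n. reach B n h z)"

lemma transition_measurable [measurable (raw)]:
  assumes [measurable]: "B \<in> sets S" "f \<in> borel_measurable L" "g \<in> L \<rightarrow>\<^sub>M S"
  shows "(\<lambda>x. transition B (f x) (g x)) \<in> borel_measurable L"
  unfolding transition_def by measurable

lemma transition_0:
  assumes "z \<in> space S"
  shows "transition B 0 z = indicator B z"
proof -
  have "(\<Sum>n. reach B n 0 z) = (\<Sum>n\<in>{count z}. reach B n 0 z)"
    using assms by (intro suminf_finite) (auto simp: reach_0)
  then show ?thesis using assms by (simp add: transition_def reach_0)
qed

theorem transition_markov:
  assumes st: "0 \<le> s" "s \<le> t" "t \<le> T" and A: "A \<in> sets (F s)" and B [measurable]: "B \<in> sets S"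
  shows "(\<integral>\<^sup>+\<omega>\<in>A. transition B (t - s) (Y s \<omega>) \<partial>M) = (\<integral>\<^sup>+\<omega>\<in>A. indicator B (Y t \<omega>) \<partial>M)"
proof -
  have [measurable]: "A \<in> sets M" using A F_sub[of s] st by auto
  have [measurable]: "Y s \<in> M \<rightarrow>\<^sub>M S" "Y t \<in> M \<rightarrow>\<^sub>M S"
    using F_measurable_M[OF Y_adapted[of s]] F_measurable_M[OF Y_adapted[of t]] st by simp_all
  have sum: "(\<integral>\<^sup>+\<omega>\<in>A. transition B h (Y r \<omega>) \<partial>M) = (\<Sum>n. \<integral>\<^sup>+\<omega>\<in>A. reach B n h (Y r \<omega>) \<partial>M)"
    if [measurable]: "Y r \<in> M \<rightarrow>\<^sub>M S" for r h
    by (subst nn_integral_suminf[symmetric]) (auto simp: transition_def)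
  have "(\<integral>\<^sup>+\<omega>\<in>A. transition B (t - s) (Y s \<omega>) \<partial>M) = (\<integral>\<^sup>+\<omega>\<in>A. transition B 0 (Y t \<omega>) \<partial>M)"
    by (simp add: sum reach_martingale[OF st A B])
  also have "\<dots> = (\<integral>\<^sup>+\<omega>\<in>A. indicator B (Y t \<omega>) \<partial>M)"
    by (intro nn_integral_cong) (simp add: transition_0 Y_in_space)
  finally show ?thesis .
qed

text \<open>The sigma-algebra \<open>G\<close> stands for the whole past as well as for the present state: all that matters is
  that it lies in the history and that the state at time \<open>s\<close> is \<open>G\<close>-measurable. The finiteness of
  \<open>transition\<close> along \<open>W\<close> follows from its expectation being a probability.\<close>

lemma conditional_expectation_transition:
  assumes st: "0 \<le> s" "s \<le> t" "t \<le> T" and B [measurable]: "B \<in> sets S"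
    and G: "space G = space M" "sets G \<subseteq> sets (F s)"
    and W: "W \<in> G \<rightarrow>\<^sub>M S" "AE \<omega> in M. W \<omega> = Y s \<omega>"
    and V [measurable]: "V \<in> M \<rightarrow>\<^sub>M S" and VY: "AE \<omega> in M. V \<omega> = Y t \<omega>"
  shows "AE \<omega> in M. real_cond_exp M G (\<lambda>\<omega>. indicator B (V \<omega>)) \<omega> = enn2real (transition B (t - s) (W \<omega>))"
proof -
  have sub: "subalgebra M G"
    using G F_sub[of s] st by (auto simp: subalgebra_def)
  interpret G: sigma_finite_subalgebra M G
    by (intro finite_measure_subalgebra_is_sigma_finite finite_measure_subalgebra.intro
        finite_measure_subalgebra_axioms.intro finite_measure_axioms sub)
  have [measurable]: "W \<in> M \<rightarrow>\<^sub>M S" by (rule measurable_from_subalg[OF sub W(1)])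
  let ?\<phi> = "\<lambda>\<omega>. transition B (t - s) (W \<omega>)"
  have set: "(\<integral>\<^sup>+\<omega>\<in>A. ?\<phi> \<omega> \<partial>M) = (\<integral>\<^sup>+\<omega>\<in>A. indicator B (V \<omega>) \<partial>M)" if A: "A \<in> sets G" for A
  proof -
    have "(\<integral>\<^sup>+\<omega>\<in>A. ?\<phi> \<omega> \<partial>M) = (\<integral>\<^sup>+\<omega>\<in>A. transition B (t - s) (Y s \<omega>) \<partial>M)"
      using W(2) by (intro nn_integral_cong_AE) auto
    also have "\<dots> = (\<integral>\<^sup>+\<omega>\<in>A. indicator B (Y t \<omega>) \<partial>M)"
      using A G by (intro transition_markov st B) auto
    also have "\<dots> = (\<integral>\<^sup>+\<omega>\<in>A. indicator B (V \<omega>) \<partial>M)"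
      using VY by (intro nn_integral_cong_AE) auto
    finally show ?thesis .
  qed
  have "(\<integral>\<^sup>+\<omega>. ?\<phi> \<omega> \<partial>M) = (\<integral>\<^sup>+\<omega>\<in>space M. ?\<phi> \<omega> \<partial>M)"
    by (intro nn_integral_cong) auto
  also have "\<dots> = (\<integral>\<^sup>+\<omega>\<in>space M. indicator B (V \<omega>) \<partial>M)"
    by (rule set) (use sets.top[of G] G in simp)
  also have "\<dots> \<le> (\<integral>\<^sup>+\<omega>. 1 \<partial>M)"
    by (intro nn_integral_mono) (auto split: split_indicator)
  finally have "(\<integral>\<^sup>+\<omega>. ?\<phi> \<omega> \<partial>M) \<le> 1" by (simp add: emeasure_space_1)
  then have "(\<integral>\<^sup>+\<omega>. ?\<phi> \<omega> \<partial>M) \<noteq> \<infinity>" by (auto simp: top_unique)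
  then have fin: "AE \<omega> in M. ?\<phi> \<omega> \<noteq> \<infinity>"
    by (intro nn_integral_noteq_infinite) auto
  have int: "integrable M (\<lambda>\<omega>. enn2real (?\<phi> \<omega>))"
  proof (rule integrableI_bounded)
    have "(\<integral>\<^sup>+\<omega>. ennreal (norm (enn2real (?\<phi> \<omega>))) \<partial>M) = (\<integral>\<^sup>+\<omega>. ?\<phi> \<omega> \<partial>M)"
      using fin by (intro nn_integral_cong_AE) (auto elim!: eventually_mono simp: ennreal_enn2real less_top)
    also have "\<dots> < \<infinity>" using \<open>_ \<le> 1\<close> by (rule le_less_trans) simp
    finally show "(\<integral>\<^sup>+\<omega>. ennreal (norm (enn2real (?\<phi> \<omega>))) \<partial>M) < \<infinity>" .
  qed simp
  show ?thesis
  proof (rule G.real_cond_exp_charact)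
    show "integrable M (\<lambda>\<omega>. enn2real (?\<phi> \<omega>))" by (rule int)
    show int2: "integrable M (\<lambda>\<omega>. indicator B (V \<omega>) :: real)"
      by (rule integrable_const_bound[where B=1]) (auto split: split_indicator)
    show "(\<lambda>\<omega>. enn2real (?\<phi> \<omega>)) \<in> borel_measurable G" using W(1) by measurable
    fix A assume A: "A \<in> sets G"
    then have [measurable]: "A \<in> sets M" using sub by (auto simp: subalgebra_def)
    have "(\<integral>\<omega>\<in>A. indicator B (V \<omega>) \<partial>M) = enn2real (\<integral>\<^sup>+\<omega>\<in>A. indicator B (V \<omega>) \<partial>M)"
      unfolding set_lebesgue_integral_def
      by (subst integral_eq_nn_integral) (auto intro!: arg_cong[where f=enn2real] nn_integral_cong split: split_indicator)
    also have "\<dots> = enn2real (\<integral>\<^sup>+\<omega>\<in>A. ?\<phi> \<omega> \<partial>M)" by (simp add: set[OF A])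
    also have "\<dots> = (\<integral>\<omega>\<in>A. enn2real (?\<phi> \<omega>) \<partial>M)"
      unfolding set_lebesgue_integral_def using fin
      by (subst integral_eq_nn_integral)
        (auto intro!: arg_cong[where f=enn2real] nn_integral_cong_AE elim!: eventually_mono simp: ennreal_enn2real less_top split: split_indicator)
    finally show "(\<integral>\<omega>\<in>A. indicator B (V \<omega>) \<partial>M) = (\<integral>\<omega>\<in>A. enn2real (?\<phi> \<omega>) \<partial>M)" .
  qed
qed

text \<open>Changing \<open>Y\<close> on null sets, a different one for each time, is harmless as long as the result stays adapted:
  conditional expectations given the past and given the present are both equal to the same function
  of \<open>Z s\<close>.\<close>

theorem markov_modification:
  assumes Z: "\<And>t. 0 \<le> t \<Longrightarrow> t \<le> T \<Longrightarrow> Z t \<in> F t \<rightarrow>\<^sub>M S"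
    and ZY: "\<And>t. 0 \<le> t \<Longrightarrow> t \<le> T \<Longrightarrow> AE \<omega> in M. Z t \<omega> = Y t \<omega>"
  shows "markov_process M S T Z"
  unfolding markov_process_def
proof (intro conjI ballI)
  show "prob_space M" by (rule prob_space_axioms)
  show ZM: "Z t \<in> M \<rightarrow>\<^sub>M S" if "t \<in> {0..T}" for t
    using F_measurable_M[OF Z[of t]] that by simp
  fix s t B assume s: "s \<in> {0..T}" and t: "t \<in> {s..T}" and B: "B \<in> sets S"
  let ?\<phi> = "\<lambda>\<omega>. enn2real (transition B (t - s) (Z s \<omega>))"
  have cond: "AE \<omega> in M. real_cond_exp M G (\<lambda>\<omega>. indicator B (Z t \<omega>)) \<omega> = ?\<phi> \<omega>"
    if "space G = space M" "sets G \<subseteq> sets (F s)" "Z s \<in> G \<rightarrow>\<^sub>M S" for G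
    using s t that B by (intro conditional_expectation_transition ZY ZM) auto
  let ?P = "{Z r -` C \<inter> space M | r C. r \<in> {0..s} \<and> C \<in> sets S}"
  have P: "?P \<subseteq> Pow (space M)" by auto
  have P_F: "?P \<subseteq> sets (F s)"
  proof
    fix D assume "D \<in> ?P"
    then obtain r C where D: "D = Z r -` C \<inter> space M" "0 \<le> r" "r \<le> s" "C \<in> sets S" by auto
    then have "Z r \<in> F s \<rightarrow>\<^sub>M S" using s by (intro F_measurable_mono[OF Z]) auto
    from measurable_sets[OF this D(4)] show "D \<in> sets (F s)" by (simp add: D(1) F_space)
  qed
  have past: "AE \<omega> in M. real_cond_exp M (past M S Z s) (\<lambda>\<omega>. indicator B (Z t \<omega>)) \<omega> = ?\<phi> \<omega>"
  proof (rule cond)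
    show sp: "space (past M S Z s) = space M" by (simp add: past_def space_measure_of_conv)
    have sets: "sets (past M S Z s) = sigma_sets (space M) ?P"
      unfolding past_def by (rule sets_measure_of[OF P])
    show "sets (past M S Z s) \<subseteq> sets (F s)"
      unfolding sets using sets.sigma_sets_subset[OF P_F] by (simp add: F_space)
    show "Z s \<in> past M S Z s \<rightarrow>\<^sub>M S"
    proof (rule measurableI)
      show "Z s \<omega> \<in> space S" if "\<omega> \<in> space (past M S Z s)" for \<omega>
        using measurable_space[OF ZM[OF s]] that sp by simp
      show "Z s -` C \<inter> space (past M S Z s) \<in> sets (past M S Z s)" if "C \<in> sets S" for C
        unfolding sets sp using s that by (intro sigma_sets.Basic) auto
    qed
  qed
  have present: "AE \<omega> in M. real_cond_exp M (vimage_algebra (space M) (Z s) S) (\<lambda>\<omega>. indicator B (Z t \<omega>)) \<omega> = ?\<phi> \<omega>"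
  proof (rule cond)
    have Zs: "Z s \<in> space M \<rightarrow> space S" using measurable_space[OF ZM[OF s]] by auto
    show "Z s \<in> vimage_algebra (space M) (Z s) S \<rightarrow>\<^sub>M S"
      by (rule measurable_vimage_algebra1[OF Zs])
    have "sets (vimage_algebra (space M) (Z s) S) = {Z s -` C \<inter> space M | C. C \<in> sets S}"
      by (rule sets_vimage_algebra2[OF Zs])
    also have "\<dots> \<subseteq> ?P" using s by auto
    finally show "sets (vimage_algebra (space M) (Z s) S) \<subseteq> sets (F s)" using P_F by blast
  qed simp
  from past present show "AE \<omega> in M. real_cond_exp M (past M S Z s) (\<lambda>\<omega>. indicator B (Z t \<omega>)) \<omega> =
      real_cond_exp M (vimage_algebra (space M) (Z s) S) (\<lambda>\<omega>. indicator B (Z t \<omega>)) \<omega>"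
    by eventually_elim simp
qed

end

section \<open>Hawkes processes with exponential-sum kernels\<close>

lemma measurable_nat_of_real:
  assumes "(\<lambda>x. real (f x)) \<in> borel_measurable L"
  shows "f \<in> L \<rightarrow>\<^sub>M count_space UNIV"
proof -
  have "(\<lambda>x. nat \<lfloor>real (f x)\<rfloor>) \<in> L \<rightarrow>\<^sub>M count_space UNIV"
    using assms by measurable
  then show ?thesis by simp
qed

lemma eventually_at_left_Int_lessThan:
  fixes J :: "real set"
  assumes "finite J"
  shows "eventually (\<lambda>x. J \<inter> {..<x} = J \<inter> {..<r}) (at_left r)"
proof -
  have "eventually (\<lambda>x. \<forall>s\<in>J. s < r \<longrightarrow> s < x) (at_left r)"
    using assms
  proof (rule eventually_ball_finite, intro ballI)
    fix s show "eventually (\<lambda>x. s < r \<longrightarrow> s < x) (at_left r)"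
      by (cases "s < r") (auto intro: eventually_mono[OF eventually_at_left_real])
  qed
  moreover have "eventually (\<lambda>x. x < r) (at_left r)"
    by (simp add: eventually_at_filter)
  ultimately show ?thesis by eventually_elim auto
qed

type_synonym counts_levels = "(nat \<Rightarrow> nat) \<times> (nat \<Rightarrow> nat \<Rightarrow> real)"

abbreviation hawkes_state :: "nat \<Rightarrow> nat \<Rightarrow> counts_levels measure" where
  "hawkes_state d K \<equiv> count_state d \<Otimes>\<^sub>M real_state d K"

lemma hawkes_state_measurable:
  assumes "\<And>u. u \<in> {1..d} \<Longrightarrow> c u \<in> L \<rightarrow>\<^sub>M count_space UNIV"
    and "\<And>k u. k \<in> {0..K} \<Longrightarrow> u \<in> {1..d} \<Longrightarrow> l k u \<in> borel_measurable L"
  shows "(\<lambda>x. (\<lambda>u\<in>{1..d}. c u x, \<lambda>k\<in>{0..K}. \<lambda>u\<in>{1..d}. l k u x)) \<in> L \<rightarrow>\<^sub>M hawkes_state d K"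
  using assms by (intro measurable_Pair measurable_restrict)

lemma hawkes_state_components:
  "u \<in> {1..d} \<Longrightarrow> (\<lambda>z. fst z u) \<in> hawkes_state d K \<rightarrow>\<^sub>M count_space UNIV"
  "k \<in> {0..K} \<Longrightarrow> u \<in> {1..d} \<Longrightarrow> (\<lambda>z. snd z k u) \<in> borel_measurable (hawkes_state d K)"
proof -
  show "(\<lambda>z. fst z u) \<in> hawkes_state d K \<rightarrow>\<^sub>M count_space UNIV" if "u \<in> {1..d}"
    by (rule measurable_compose[OF measurable_fst measurable_component_singleton[OF that]])
  show "(\<lambda>z. snd z k u) \<in> borel_measurable (hawkes_state d K)" if "k \<in> {0..K}" "u \<in> {1..d}"
    by (rule measurable_compose[OF measurable_compose[OF measurable_snd measurable_component_singleton[OF that(1)]]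
          measurable_component_singleton[OF that(2)]])
qed

lemma space_hawkes_state_eqI:
  assumes "z \<in> space (hawkes_state d K)" "z' \<in> space (hawkes_state d K)"
    and "\<And>u. u \<in> {1..d} \<Longrightarrow> fst z u = fst z' u"
    and "\<And>k u. k \<in> {0..K} \<Longrightarrow> u \<in> {1..d} \<Longrightarrow> snd z k u = snd z' k u"
  shows "z = z'"
proof (rule prod_eqI)
  show "fst z = fst z'"
    using assms by (intro PiE_ext[of "fst z" "{1..d}" "\<lambda>_. UNIV" "fst z'"]) (auto simp: space_pair_measure space_PiM mem_Times_iff)
  show "snd z = snd z'"
  proof (rule PiE_ext)
    show "snd z \<in> {0..K} \<rightarrow>\<^sub>E space (PiM {1..d} (\<lambda>u. borel))" "snd z' \<in> {0..K} \<rightarrow>\<^sub>E space (PiM {1..d} (\<lambda>u. borel))"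
      using assms by (auto simp: space_pair_measure space_PiM mem_Times_iff)
    fix k assume k: "k \<in> {0..K}"
    with assms(1,2) have "snd z k \<in> {1..d} \<rightarrow>\<^sub>E UNIV" "snd z' k \<in> {1..d} \<rightarrow>\<^sub>E UNIV"
      by (auto simp: space_pair_measure space_PiM mem_Times_iff PiE_mem)
    then show "snd z k = snd z' k" by (rule PiE_ext) (use assms(4) k in auto)
  qed
qed

definition decay :: "nat \<Rightarrow> nat \<Rightarrow> real \<Rightarrow> real \<Rightarrow> counts_levels \<Rightarrow> counts_levels"
  where "decay d K \<alpha> q z =
    (\<lambda>u\<in>{1..d}. fst z u, \<lambda>k\<in>{0..K}. \<lambda>u\<in>{1..d}. snd z k u * exp (- (real k * \<alpha> * q)))"

definition event :: "nat \<Rightarrow> nat \<Rightarrow> (nat \<Rightarrow> nat \<Rightarrow> nat \<Rightarrow> real) \<Rightarrow> nat \<Rightarrow> counts_levels \<Rightarrow> counts_levels"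
  where "event d K X v z =
    (\<lambda>u\<in>{1..d}. fst z u + (if u = v then 1 else 0), \<lambda>k\<in>{0..K}. \<lambda>u\<in>{1..d}. snd z k u + X u v k)"

definition level_rate :: "nat \<Rightarrow> nat \<Rightarrow> counts_levels \<Rightarrow> real"
  where "level_rate K u z = max (\<Sum>k=0..K. snd z k u) 0"

definition event_count :: "nat \<Rightarrow> counts_levels \<Rightarrow> nat"
  where "event_count d z = (\<Sum>u=1..d. fst z u)"

lemma hawkes_jump_flow:
  "jump_flow (hawkes_state d K) {1..d} (decay d K \<alpha>) (event d K X) (level_rate K) (event_count d)"
proof
  let ?S = "hawkes_state d K"
  have decay_meas: "(\<lambda>x. decay d K \<alpha> (fst x) (snd x)) \<in> borel \<Otimes>\<^sub>M ?S \<rightarrow>\<^sub>M ?S"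
    unfolding decay_def
  proof (intro hawkes_state_measurable borel_measurable_times)
    show "(\<lambda>x. exp (- (real k * \<alpha> * fst x))) \<in> borel_measurable (borel \<Otimes>\<^sub>M ?S)" for k by measurable
    show "(\<lambda>x. fst (snd x) u) \<in> borel \<Otimes>\<^sub>M ?S \<rightarrow>\<^sub>M count_space UNIV" if "u \<in> {1..d}" for u
      by (rule measurable_compose[OF measurable_snd hawkes_state_components(1)[OF that]])
    show "(\<lambda>x. snd (snd x) k u) \<in> borel_measurable (borel \<Otimes>\<^sub>M ?S)" if "k \<in> {0..K}" "u \<in> {1..d}" for k u
      by (rule measurable_compose[OF measurable_snd hawkes_state_components(2)[OF that]])
  qed
  then show "(\<lambda>(q, z). decay d K \<alpha> q z) \<in> borel \<Otimes>\<^sub>M ?S \<rightarrow>\<^sub>M ?S" by (simp add: case_prod_beta')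
  note [measurable] = hawkes_state_components
  show event_meas: "event d K X u \<in> ?S \<rightarrow>\<^sub>M ?S" if "u \<in> {1..d}" for u
    unfolding event_def[abs_def] by (intro hawkes_state_measurable) measurable
  show "level_rate K u \<in> borel_measurable ?S" if "u \<in> {1..d}" for u
    unfolding level_rate_def[abs_def] using that by measurable
  show "event_count d \<in> ?S \<rightarrow>\<^sub>M count_space UNIV"
    unfolding event_count_def[abs_def] by measurable
  fix z assume z: "z \<in> space ?S"
  have sp: "decay d K \<alpha> q z \<in> space ?S" if "z \<in> space ?S" for q z
    using measurable_space[OF decay_meas, of "(q, z)"] that by (simp add: space_pair_measure)
  show "decay d K \<alpha> 0 z = z"
    by (intro space_hawkes_state_eqI[of _ d K] sp z) (auto simp: decay_def)
  show "decay d K \<alpha> p (decay d K \<alpha> q z) = decay d K \<alpha> (p + q) z" for p q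
    by (intro space_hawkes_state_eqI[of _ d K] sp z)
       (auto simp: decay_def algebra_simps mult_exp_exp)
  show "continuous_on UNIV (\<lambda>q. level_rate K u (decay d K \<alpha> q z))" if "u \<in> {1..d}" for u
  proof -
    have "level_rate K u (decay d K \<alpha> q z) = max (\<Sum>k=0..K. snd z k u * exp (- (real k * \<alpha> * q))) 0" for q
      unfolding level_rate_def decay_def using that by (intro arg_cong2[where f=max] sum.cong) auto
    then show ?thesis by (simp add: continuous_intros)
  qed
  show "event_count d (decay d K \<alpha> q z) = event_count d z" for q
    unfolding event_count_def decay_def by (intro sum.cong) auto
  show "event_count d (event d K X u z) = Suc (event_count d z)" if "u \<in> {1..d}" for u
  proof -
    have "event_count d (event d K X u z) = (\<Sum>v=1..d. fst z v + (if v = u then 1 else 0))"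
      unfolding event_count_def event_def by (intro sum.cong) auto
    then show ?thesis using that by (simp add: sum.distrib event_count_def)
  qed
qed (auto simp: level_rate_def)

locale exponential_hawkes =
  fixes M :: "'w measure" and d K :: nat and \<alpha> T :: real
    and X :: "nat \<Rightarrow> nat \<Rightarrow> nat \<Rightarrow> real" and N :: "nat \<Rightarrow> real \<Rightarrow> 'w \<Rightarrow> nat"
  assumes T_pos: "0 < T"
    and hawkes: "hawkes_process M d T (\<lambda>u. exp_comb K \<alpha> (X u 0)) (\<lambda>u v. exp_comb K \<alpha> (X u v)) N"
begin

sublocale prob_space M
  using hawkes by (simp add: hawkes_process_def)

definition J :: "nat \<Rightarrow> 'w \<Rightarrow> real set" where
  "J v \<omega> = jump_times T (\<lambda>t. N v t \<omega>)"

text \<open>The contribution of the \<open>k\<close>-th exponential to the rate of \<open>u\<close>, before taking the positive part. As in the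
  rate itself, an event at \<open>t\<close> does not yet contribute at \<open>t\<close>; this makes the levels left-continuous.\<close>

definition level :: "nat \<Rightarrow> nat \<Rightarrow> real \<Rightarrow> 'w \<Rightarrow> real" where
  "level k u t \<omega> = X u 0 k * exp (- (real k * \<alpha> * t))
    + (\<Sum>v=1..d. \<Sum>s\<in>J v \<omega> \<inter> {..<t}. X u v k * exp (- (real k * \<alpha> * (t - s))))"

definition left_state :: "real \<Rightarrow> 'w \<Rightarrow> counts_levels" where
  "left_state t \<omega> = (\<lambda>u\<in>{1..d}. card (J u \<omega> \<inter> {..<t}), \<lambda>k\<in>{0..K}. \<lambda>u\<in>{1..d}. level k u t \<omega>)"

lemma hawkes_rate_levels:
  "hawkes_rate d T (\<lambda>u. exp_comb K \<alpha> (X u 0)) (\<lambda>u v. exp_comb K \<alpha> (X u v)) N u t \<omega>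
     = max (\<Sum>k=0..K. level k u t \<omega>) 0"
proof -
  have "(\<Sum>v=1..d. \<Sum>s\<in>J v \<omega> \<inter> {..<t}. exp_comb K \<alpha> (X u v) (t - s))
    = (\<Sum>k=0..K. \<Sum>v=1..d. \<Sum>s\<in>J v \<omega> \<inter> {..<t}. X u v k * exp (- (real k * \<alpha> * (t - s))))"
  proof -
    have "(\<Sum>v=1..d. \<Sum>s\<in>J v \<omega> \<inter> {..<t}. exp_comb K \<alpha> (X u v) (t - s))
      = (\<Sum>v=1..d. \<Sum>k=0..K. \<Sum>s\<in>J v \<omega> \<inter> {..<t}. X u v k * exp (- (real k * \<alpha> * (t - s))))"
      unfolding exp_comb_def by (intro sum.cong refl sum.swap)
    also have "\<dots> = (\<Sum>k=0..K. \<Sum>v=1..d. \<Sum>s\<in>J v \<omega> \<inter> {..<t}. X u v k * exp (- (real k * \<alpha> * (t - s))))"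
      by (rule sum.swap)
    finally show ?thesis .
  qed
  then show ?thesis
    unfolding hawkes_rate_def J_def[symmetric]
    by (simp add: level_def sum.distrib) (simp add: exp_comb_def)
qed

lemma level_rate_left_state:
  assumes "u \<in> {1..d}"
  shows "level_rate K u (left_state t \<omega>) = max (\<Sum>k=0..K. level k u t \<omega>) 0"
  unfolding level_rate_def left_state_def using assms by (intro arg_cong2[where f=max] sum.cong) auto

lemma J_subset: "J v \<omega> \<subseteq> {0<..T}"
  unfolding J_def by (rule jump_times_subset)

lemma J_finite: "v \<in> {1..d} \<Longrightarrow> \<omega> \<in> space M \<Longrightarrow> finite (J v \<omega>)"
  using hawkes by (auto simp: hawkes_process_def counting_process_def counting_path_def J_def)

lemma N_card: "v \<in> {1..d} \<Longrightarrow> \<omega> \<in> space M \<Longrightarrow> 0 \<le> t \<Longrightarrow> t \<le> T \<Longrightarrow> N v t \<omega> = card (J v \<omega> \<inter> {..t})"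
  using hawkes by (auto simp: hawkes_process_def counting_process_def counting_path_def J_def)

lemma N_meas: "v \<in> {1..d} \<Longrightarrow> 0 \<le> t \<Longrightarrow> t \<le> T \<Longrightarrow> N v t \<in> M \<rightarrow>\<^sub>M count_space UNIV"
  using hawkes by (auto simp: hawkes_process_def counting_process_def)

lemma N_intensity: "u \<in> {1..d} \<Longrightarrow> has_intensity M (history M d N) T (N u)
    (hawkes_rate d T (\<lambda>u. exp_comb K \<alpha> (X u 0)) (\<lambda>u v. exp_comb K \<alpha> (X u v)) N u)"
  using hawkes by (auto simp: hawkes_process_def)

lemma N_adapted: "u \<in> {1..d} \<Longrightarrow> 0 \<le> t \<Longrightarrow> t \<le> T \<Longrightarrow> N u t \<in> history M d N t \<rightarrow>\<^sub>M count_space UNIV"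
  using N_intensity[of u] by (simp add: has_intensity_def)

lemma history_filtration: "finite_horizon_filtration M (history M d N) T"
proof
  define G where "G t = {(\<lambda>\<omega>. \<lambda>u\<in>{1..d}. N u s \<omega>) -` B \<inter> space M | s B. s \<in> {0..t} \<and> B \<in> sets (count_state d)}" for t
  have G: "G t \<subseteq> Pow (space M)" for t by (auto simp: G_def)
  have sets: "sets (history M d N t) = sigma_sets (space M) (G t)" for t
    unfolding history_def past_def G_def[symmetric] by (rule sets_measure_of[OF G])
  show "space (history M d N t) = space M" for t
    by (simp add: history_def past_def space_measure_of_conv)
  show "sets (history M d N s) \<subseteq> sets (history M d N t)" if "s \<le> t" for s t
    unfolding sets using that by (intro sigma_sets_mono') (fastforce simp: G_def)
  show "sets (history M d N t) \<subseteq> sets M" if t: "0 \<le> t" "t \<le> T" for t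
    unfolding sets
  proof (rule sets.sigma_sets_subset)
    show "G t \<subseteq> sets M"
    proof
      fix D assume "D \<in> G t"
      then obtain s B where D: "D = (\<lambda>\<omega>. \<lambda>u\<in>{1..d}. N u s \<omega>) -` B \<inter> space M" "0 \<le> s" "s \<le> t" "B \<in> sets (count_state d)"
        by (auto simp: G_def)
      have "(\<lambda>\<omega>. \<lambda>u\<in>{1..d}. N u s \<omega>) \<in> M \<rightarrow>\<^sub>M count_state d"
        using D t by (intro measurable_restrict N_meas) auto
      then show "D \<in> sets M" unfolding D(1) by (rule measurable_sets[OF _ D(4)])
    qed
  qed
qed

sublocale finite_horizon_filtration M "history M d N" T
  by (rule history_filtration)

lemma level_adapted:
  assumes t: "0 \<le> t" "t \<le> T"
  shows "level k u t \<in> borel_measurable (history M d N t)"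
proof -
  have "(\<lambda>\<omega>. \<Sum>s\<in>J v \<omega> \<inter> {..<t}. exp (- (real k * \<alpha> * (t - s)))) \<in> borel_measurable (history M d N t)"
    if v: "v \<in> {1..d}" for v
    using t J_finite[OF v] J_subset
  proof (intro adapted_jump_sum)
    fix r assume r: "0 \<le> r" "r \<le> T"
    show "(\<lambda>\<omega>. card (J v \<omega> \<inter> {..r})) \<in> history M d N r \<rightarrow>\<^sub>M count_space UNIV"
      by (rule measurable_cong[THEN iffD1, OF _ N_adapted[OF v r]]) (simp add: N_card[OF v _ r] F_space)
  qed auto
  then have "(\<lambda>\<omega>. X u 0 k * exp (- (real k * \<alpha> * t)) + (\<Sum>v=1..d. X u v k * (\<Sum>s\<in>J v \<omega> \<inter> {..<t}. exp (- (real k * \<alpha> * (t - s))))))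
      \<in> borel_measurable (history M d N t)"
    by measurable
  then show ?thesis by (simp add: level_def[abs_def] sum_distrib_left)
qed

lemma left_count_adapted:
  assumes t: "0 \<le> t" "t \<le> T" and v: "v \<in> {1..d}"
  shows "(\<lambda>\<omega>. real (card (J v \<omega> \<inter> {..<t}))) \<in> borel_measurable (history M d N t)"
proof -
  have "(\<lambda>\<omega>. \<Sum>s\<in>J v \<omega> \<inter> {..<t}. 1 :: real) \<in> borel_measurable (history M d N t)"
    using t J_finite[OF v] J_subset
  proof (intro adapted_jump_sum)
    fix r assume r: "0 \<le> r" "r \<le> T"
    show "(\<lambda>\<omega>. card (J v \<omega> \<inter> {..r})) \<in> history M d N r \<rightarrow>\<^sub>M count_space UNIV"
      by (rule measurable_cong[THEN iffD1, OF _ N_adapted[OF v r]]) (simp add: N_card[OF v _ r] F_space)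
  qed auto
  then show ?thesis by simp
qed

lemma level_left_continuous:
  assumes "\<omega> \<in> space M"
  shows "((\<lambda>t. level k u t \<omega>) \<longlongrightarrow> level k u r \<omega>) (at_left r)"
proof -
  let ?l = "\<lambda>J t. X u 0 k * exp (- (real k * \<alpha> * t))
    + (\<Sum>v=1..d. \<Sum>s\<in>J v. X u v k * exp (- (real k * \<alpha> * (t - s))))"
  have "((\<lambda>t. ?l (\<lambda>v. J v \<omega> \<inter> {..<r}) t) \<longlongrightarrow> ?l (\<lambda>v. J v \<omega> \<inter> {..<r}) r) (at_left r)"
    by (intro tendsto_intros)
  moreover have "eventually (\<lambda>t. \<forall>v\<in>{1..d}. J v \<omega> \<inter> {..<t} = J v \<omega> \<inter> {..<r}) (at_left r)"
    using assms by (intro eventually_ball_finite ballI eventually_at_left_Int_lessThan J_finite) auto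
  then have "eventually (\<lambda>t. ?l (\<lambda>v. J v \<omega> \<inter> {..<r}) t = level k u t \<omega>) (at_left r)"
    by eventually_elim (simp add: level_def)
  ultimately show ?thesis
    unfolding level_def[of k u r] by (rule Lim_transform_eventually)
qed

lemma left_state_adapted:
  assumes "0 \<le> t" "t \<le> T"
  shows "left_state t \<in> history M d N t \<rightarrow>\<^sub>M hawkes_state d K"
  unfolding left_state_def[abs_def]
  by (intro hawkes_state_measurable measurable_nat_of_real left_count_adapted level_adapted assms)

lemma left_state_predictable:
  "(\<lambda>(r, \<omega>). left_state r \<omega>) \<in> Pred \<rightarrow>\<^sub>M hawkes_state d K"
proof -
  have "(\<lambda>x. left_state (fst x) (snd x)) \<in> Pred \<rightarrow>\<^sub>M hawkes_state d K"
    unfolding left_state_def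
  proof (intro hawkes_state_measurable measurable_nat_of_real)
    fix u assume u: "u \<in> {1..d}"
    have "(\<lambda>(r, \<omega>). real (card (J u \<omega> \<inter> {..<r}))) \<in> borel_measurable Pred"
    proof (rule left_continuous_adapted_predictable)
      show "((\<lambda>t. real (card (J u \<omega> \<inter> {..<t}))) \<longlongrightarrow> real (card (J u \<omega> \<inter> {..<r}))) (at_left r)"
        if "\<omega> \<in> space M" for r \<omega>
        by (rule tendsto_eventually, rule eventually_mono[OF eventually_at_left_Int_lessThan[OF J_finite[OF u that]]]) simp
    qed (rule left_count_adapted[OF _ _ u])
    then show "(\<lambda>x. real (card (J u (snd x) \<inter> {..<fst x}))) \<in> borel_measurable Pred"
      by (simp add: case_prod_beta')
  next
    fix k u
    have "(\<lambda>(r, \<omega>). level k u r \<omega>) \<in> borel_measurable Pred"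
      by (intro left_continuous_adapted_predictable level_adapted level_left_continuous)
    then show "(\<lambda>x. level k u (fst x) (snd x)) \<in> borel_measurable Pred"
      by (simp add: case_prod_beta')
  qed
  then show ?thesis by (simp add: case_prod_beta')
qed

lemma left_state_path:
  assumes \<omega>: "\<omega> \<in> space M"
  shows "(\<lambda>r. left_state r \<omega>) \<in> borel \<rightarrow>\<^sub>M hawkes_state d K"
  unfolding left_state_def
proof (intro hawkes_state_measurable measurable_nat_of_real)
  have sum: "(\<Sum>s\<in>J v \<omega> \<inter> {..<r}. f s) = (\<Sum>s\<in>J v \<omega>. if s < r then f s else 0)"
    if "v \<in> {1..d}" for v r and f :: "real \<Rightarrow> real"
    using J_finite[OF that \<omega>] by (simp add: sum.If_cases Int_def lessThan_def)
  fix u assume u: "u \<in> {1..d}"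
  have "(\<lambda>r. \<Sum>s\<in>J u \<omega>. if s < r then 1 else 0 :: real) \<in> borel_measurable borel"
    by measurable
  then show "(\<lambda>r. real (card (J u \<omega> \<inter> {..<r}))) \<in> borel_measurable borel"
    using sum[OF u, of "\<lambda>_. 1"] by simp
  fix k
  have "(\<lambda>r. X u 0 k * exp (- (real k * \<alpha> * r))
    + (\<Sum>v=1..d. \<Sum>s\<in>J v \<omega>. if s < r then X u v k * exp (- (real k * \<alpha> * (r - s))) else 0)) \<in> borel_measurable borel"
    by measurable
  then show "(\<lambda>r. level k u r \<omega>) \<in> borel_measurable borel"
    by (simp add: level_def sum)
qed

lemma exp_decay_step: "exp (- (real k * \<alpha> * (r - s))) * exp (- (real k * \<alpha> * (q - r))) = exp (- (real k * \<alpha> * (q - s)))"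
  by (simp add: mult_exp_exp algebra_simps)

lemma left_state_flow:
  assumes "r \<le> q" and none: "\<And>v. v \<in> {1..d} \<Longrightarrow> J v \<omega> \<inter> {r..<q} = {}"
  shows "left_state q \<omega> = decay d K \<alpha> (q - r) (left_state r \<omega>)"
proof -
  have J: "J v \<omega> \<inter> {..<q} = J v \<omega> \<inter> {..<r}" if "v \<in> {1..d}" for v
    using none[OF that] \<open>r \<le> q\<close> by fastforce
  have "level k u q \<omega> = level k u r \<omega> * exp (- (real k * \<alpha> * (q - r)))" for k u
    using exp_decay_step[of k r _ q] exp_decay_step[of k r 0 q]
    by (simp add: level_def J distrib_right sum_distrib_right mult.assoc)
  then show ?thesis
    by (auto simp: left_state_def decay_def J intro!: restrict_ext)
qed

lemma left_state_jump:
  assumes \<omega>: "\<omega> \<in> space M" and u: "u \<in> {1..d}" and r: "r \<in> J u \<omega>" "r < q"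
    and other: "\<And>v. v \<in> {1..d} \<Longrightarrow> v \<noteq> u \<Longrightarrow> r \<notin> J v \<omega>"
    and none: "\<And>v. v \<in> {1..d} \<Longrightarrow> J v \<omega> \<inter> {r<..<q} = {}"
  shows "left_state q \<omega> = decay d K \<alpha> (q - r) (event d K X u (left_state r \<omega>))"
proof -
  have J: "J v \<omega> \<inter> {..<q} = (if v = u then insert r (J v \<omega> \<inter> {..<r}) else J v \<omega> \<inter> {..<r})" if v: "v \<in> {1..d}" for v
  proof -
    have "x < r \<or> x = r" if "x \<in> J v \<omega>" "x < q" for x
      using none[OF v] that by (cases x r rule: linorder_cases) auto
    then show ?thesis using r other[OF v] by auto
  qed
  have card: "card (J v \<omega> \<inter> {..<q}) = card (J v \<omega> \<inter> {..<r}) + (if v = u then 1 else 0)" if "v \<in> {1..d}" for v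
    unfolding J[OF that] using J_finite[OF that \<omega>] by (cases "v = u") simp_all
  have sum: "(\<Sum>s\<in>J v \<omega> \<inter> {..<q}. f s) = (\<Sum>s\<in>J v \<omega> \<inter> {..<r}. f s) + (if v = u then f r else 0)"
    if "v \<in> {1..d}" for v and f :: "real \<Rightarrow> real"
    unfolding J[OF that] using J_finite[OF that \<omega>] by (cases "v = u") simp_all
  have level: "level k w q \<omega> = (level k w r \<omega> + X w u k) * exp (- (real k * \<alpha> * (q - r)))" for k w
    using exp_decay_step[of k r _ q] exp_decay_step[of k r 0 q] u
    by (simp add: level_def sum distrib_right sum_distrib_right mult.assoc sum.distrib)
  show ?thesis
    by (auto simp: left_state_def decay_def event_def card level intro!: restrict_ext)
qed

sublocale intensity_driven "hawkes_state d K" "{1..d}" "decay d K \<alpha>" "event d K X" "level_rate K" "event_count d"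
    M "history M d N" T N left_state
proof (intro intensity_driven.intro intensity_driven_axioms.intro hawkes_jump_flow history_filtration)
  show "AE \<omega> in M. \<forall>u\<in>{1..d}. \<forall>v\<in>{1..d}. u \<noteq> v \<longrightarrow>
      jump_times T (\<lambda>t. N u t \<omega>) \<inter> jump_times T (\<lambda>t. N v t \<omega>) = {}"
    using hawkes by (simp add: hawkes_process_def counting_process_def)
  show "counting_path T (\<lambda>t. N u t \<omega>)" if "u \<in> {1..d}" "\<omega> \<in> space M" for u \<omega>
    using hawkes that by (simp add: hawkes_process_def counting_process_def)
  show "has_intensity M (history M d N) T (N u) (\<lambda>t \<omega>. level_rate K u (left_state t \<omega>))" if "u \<in> {1..d}" for u
    using N_intensity[OF that] that by (simp add: hawkes_rate_levels[abs_def] level_rate_left_state)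
  show "event_count d (left_state r \<omega>) = (\<Sum>v\<in>{1..d}. card (jump_times T (\<lambda>t. N v t \<omega>) \<inter> {..<r}))" for r \<omega>
    unfolding event_count_def left_state_def J_def by (intro sum.cong) auto
  show "left_state q \<omega> = decay d K \<alpha> (q - r) (left_state r \<omega>)"
    if "r \<le> q" "\<And>v. v \<in> {1..d} \<Longrightarrow> jump_times T (\<lambda>t. N v t \<omega>) \<inter> {r..<q} = {}" for r q \<omega>
    using that by (intro left_state_flow) (auto simp: J_def)
  show "left_state q \<omega> = decay d K \<alpha> (q - r) (event d K X u (left_state r \<omega>))"
    if "\<omega> \<in> space M" "u \<in> {1..d}" "r \<in> jump_times T (\<lambda>t. N u t \<omega>)" "r < q"
      "\<And>v. v \<in> {1..d} \<Longrightarrow> v \<noteq> u \<Longrightarrow> r \<notin> jump_times T (\<lambda>t. N v t \<omega>)"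
      "\<And>v. v \<in> {1..d} \<Longrightarrow> jump_times T (\<lambda>t. N v t \<omega>) \<inter> {r<..<q} = {}" for u r q \<omega>
    using that by (intro left_state_jump) (auto simp: J_def)
qed (use T_pos N_meas left_state_predictable left_state_adapted left_state_path in auto)

text \<open>At a fixed time \<open>N u t\<close> counts an event at \<open>t\<close> while \<open>left_state t\<close> does not; such an event has probability
  zero.\<close>

lemma counts_levels_markov:
  "markov_process M (hawkes_state d K) T
    (\<lambda>t \<omega>. (\<lambda>u\<in>{1..d}. N u t \<omega>, \<lambda>k\<in>{0..K}. \<lambda>u\<in>{1..d}. level k u t \<omega>))"
proof (rule markov_modification)
  fix t assume t: "0 \<le> t" "t \<le> T"
  show "(\<lambda>\<omega>. (\<lambda>u\<in>{1..d}. N u t \<omega>, \<lambda>k\<in>{0..K}. \<lambda>u\<in>{1..d}. level k u t \<omega>)) \<in> history M d N t \<rightarrow>\<^sub>M hawkes_state d K"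
    by (intro hawkes_state_measurable N_adapted level_adapted t)
  have "AE \<omega> in M. \<forall>u\<in>{1..d}. t \<notin> jumps u \<omega>"
    using no_jump_at_fixed_time by (intro AE_finite_allI) auto
  with AE_space show "AE \<omega> in M. (\<lambda>u\<in>{1..d}. N u t \<omega>, \<lambda>k\<in>{0..K}. \<lambda>u\<in>{1..d}. level k u t \<omega>) = left_state t \<omega>"
  proof eventually_elim
    case (elim \<omega>)
    have "N u t \<omega> = card (J u \<omega> \<inter> {..<t})" if "u \<in> {1..d}" for u
    proof -
      have "t \<notin> J u \<omega>" using elim(2) that by (simp add: jumps_def J_def)
      then have "J u \<omega> \<inter> {..t} = J u \<omega> \<inter> {..<t}" by (auto simp: less_le)
      then show ?thesis using N_card[OF that elim(1) t] by simp
    qed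
    then show ?case by (auto simp: left_state_def intro!: restrict_ext)
  qed
qed

end

theorem proposition2:
  fixes M :: "'w measure"
    and d K :: nat
    and \<alpha> T :: real
    and X :: "nat \<Rightarrow> nat \<Rightarrow> nat \<Rightarrow> real"
    and N :: "nat \<Rightarrow> real \<Rightarrow> 'w \<Rightarrow> nat"
    and \<mu> :: "nat \<Rightarrow> real \<Rightarrow> real"
    and g :: "nat \<Rightarrow> nat \<Rightarrow> real \<Rightarrow> real"
  assumes "d \<ge> 1" and "K \<ge> 1" and "\<alpha> > 0" and "T > 0"
    and "\<mu> = (\<lambda>u. exp_comb K \<alpha> (X u 0))"
    and "g = (\<lambda>u v. exp_comb K \<alpha> (X u v))"
    and "hawkes_process M d T \<mu> g N"
  shows "\<exists>l :: nat \<Rightarrow> nat \<Rightarrow> real \<Rightarrow> 'w \<Rightarrow> real.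
    (\<forall>u\<in>{1..d}. \<forall>t\<in>{0..T}. \<forall>\<omega>\<in>space M.
       hawkes_rate d T \<mu> g N u t \<omega> = max (\<Sum>k=0..K. l k u t \<omega>) 0) \<and>
    markov_process M (count_state d \<Otimes>\<^sub>M real_state d K) T
      (\<lambda>t \<omega>. (\<lambda>u\<in>{1..d}. N u t \<omega>, \<lambda>k\<in>{0..K}. \<lambda>u\<in>{1..d}. l k u t \<omega>))"
proof -
  interpret exponential_hawkes M d K \<alpha> T X N
    using assms by unfold_locales auto
  show ?thesis
    unfolding assms(5,6) by (intro exI[of _ level] conjI ballI hawkes_rate_levels counts_levels_markov)
qed

end
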